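(* Let $n\ge 2$ and let $M$ be a real analytic compact convex hypersurface in $\mathbb R^{n+1}$ (connected, embedded, without boundary, bounding a convex set $G$). Assume that for any two points $(X',X_{n+1}),(X',\widehat X_{n+1})\in M$ with $X_{n+1}\ge \widehat X_{n+1}$ such that the segment $\{(X',\theta X_{n+1}+(1-\theta)\widehat X_{n+1}) : 0\le\theta\le 1\}$ lies in $\overline G$, one has $H(X',X_{n+1})\le H(X',\widehat X_{n+1})$. Then $M$ is symmetric with respect to some hyperplane $\{X_{n+1}=\text{constant}\}$.
   Context: Points of $\mathbb R^{n+1}$ are written $X=(X',X_{n+1})$ with $X'=(X_1,\dots,X_n)$. $G$ denotes the bounded open set bounded by $M$. $H(X)=\frac1n[k_1(X)+\cdots+k_n(X)]$ is the mean curvature of $M$ at $X$, where $k_1(X),\dots,k_n(X)$ are the principal curvatures of $M$ at $X$ with respect to the inner normal (so round spheres have positive curvatures). *)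

theory Defs
  imports "HOL-Analysis.Analysis"
begin

(* The multi-indices are the functions Basis \<rightarrow> nat, made extensional so that each
   one is counted once; "has_sum" is unconditional convergence. *)
definition real_analytic_on :: "('a::euclidean_space \<Rightarrow> real) \<Rightarrow> 'a set \<Rightarrow> bool" where
  "real_analytic_on f U \<longleftrightarrow>
     (\<forall>p\<in>U. \<exists>r>0. \<exists>c :: ('a \<Rightarrow> nat) \<Rightarrow> real. \<forall>x\<in>ball p r.
        ((\<lambda>\<alpha>. c \<alpha> * (\<Prod>b\<in>Basis. ((x - p) \<bullet> b) ^ \<alpha> b)) has_sum f x) (Basis \<rightarrow>\<^sub>E UNIV))"

(* Embedded, without boundary: locally the regular zero set of an analytic function. *)
definition real_analytic_hypersurface :: "'a::euclidean_space set \<Rightarrow> bool" where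
  "real_analytic_hypersurface M \<longleftrightarrow>
     (\<forall>p\<in>M. \<exists>U \<phi>. open U \<and> p \<in> U \<and> real_analytic_on \<phi> U \<and>
        M \<inter> U = {x\<in>U. \<phi> x = 0} \<and>
        (\<forall>x\<in>M \<inter> U. frechet_derivative \<phi> (at x) \<noteq> (\<lambda>_. 0)))"

definition tangent_space :: "'a::euclidean_space set \<Rightarrow> 'a \<Rightarrow> 'a set" where
  "tangent_space M p =
     {v. \<exists>\<gamma> e. e > 0 \<and> (\<forall>t. \<bar>t\<bar> < e \<longrightarrow> \<gamma> t \<in> M) \<and> \<gamma> 0 = p \<and>
         (\<gamma> has_vector_derivative v) (at (0::real))}"

definition inner_unit_normal :: "'a::euclidean_space set \<Rightarrow> 'a set \<Rightarrow> 'a \<Rightarrow> 'a" where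
  "inner_unit_normal M G p =
     (THE \<nu>. norm \<nu> = 1 \<and> (\<forall>v\<in>tangent_space M p. \<nu> \<bullet> v = 0) \<and>
             (\<exists>e>0. \<forall>t. 0 < t \<and> t < e \<longrightarrow> p + t *\<^sub>R \<nu> \<in> G))"

(* The derivative within M is determined only on the tangent space, which is the only
   place where the shape operator is applied below.  The minus sign makes the curvatures
   of round spheres positive for the inner normal. *)
definition shape_operator :: "'a::euclidean_space set \<Rightarrow> 'a set \<Rightarrow> 'a \<Rightarrow> 'a \<Rightarrow> 'a" where
  "shape_operator M G p v = - frechet_derivative (inner_unit_normal M G) (at p within M) v"

definition principal_space :: "'a::euclidean_space set \<Rightarrow> 'a set \<Rightarrow> 'a \<Rightarrow> real \<Rightarrow> 'a set" where
  "principal_space M G p k = {v \<in> tangent_space M p. shape_operator M G p v = k *\<^sub>R v}"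

definition principal_curvatures :: "'a::euclidean_space set \<Rightarrow> 'a set \<Rightarrow> 'a \<Rightarrow> real set" where
  "principal_curvatures M G p = {k. \<exists>v\<in>principal_space M G p k. v \<noteq> 0}"

(* Each principal curvature is repeated according to its multiplicity, i.e. the dimension
   of its eigenspace (the shape operator being self-adjoint); n = DIM('a) - 1. *)
definition mean_curvature :: "'a::euclidean_space set \<Rightarrow> 'a set \<Rightarrow> 'a \<Rightarrow> real" where
  "mean_curvature M G p =
     (\<Sum>k\<in>principal_curvatures M G p. real (dim (principal_space M G p k)) * k)
       / real (DIM('a) - 1)"

(* Reflection in the hyperplane of points whose last coordinate is c. *)
definition reflect_last :: "real \<Rightarrow> 'b \<times> real \<Rightarrow> 'b \<times> real" where
  "reflect_last c X = (fst X, 2 * c - snd X)"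

end

theory Submission
  imports Defs
begin

text \<open>Write \<open>\<Omega>\<close> for the projection of the convex body to \<open>\<real>\<^sup>n\<close>; over \<open>\<Omega>\<close> the body lies between the graph of
a convex function \<open>f\<close> and the graph of a concave function \<open>g\<close>. The horizontal parts \<open>y\<^sub>g\<close> and
\<open>y\<^sub>f\<close> of the inner unit normals along the two graphs are bounded vector fields on \<open>\<Omega>\<close>, and the mean
curvature at a point of either graph is \<open>- div y / n\<close>. Hence the hypothesis, applied to the two endpoints
of each vertical chord, says exactly that \<open>div (y\<^sub>g - y\<^sub>f) \<ge> 0\<close> on \<open>\<Omega>\<close>.

Choose a constant with \<open>u = g + f + const \<ge> 0\<close> and put \<open>F = u (y\<^sub>g - y\<^sub>f)\<close>. Then
\<open>div F = u div (y\<^sub>g - y\<^sub>f) + \<nabla>(g + f) \<bullet> (y\<^sub>g - y\<^sub>f)\<close>. The first summand is nonnegative by hypothesis.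
The second one is nonnegative because \<open>\<nabla>v / sqrt (1 + \<bar>\<nabla>v\<bar>\<^sup>2)\<close> is a strictly monotone function of the
gradient \<open>\<nabla>v\<close>, here evaluated at \<open>v = g\<close> and \<open>v = - f\<close>; it vanishes only where
\<open>\<nabla>(g + f) = 0\<close>. At a boundary point of \<open>\<Omega>\<close> both normals become the unique supporting normal of the
vertical fibre over that point, which is horizontal, so \<open>F\<close> tends to zero at the boundary. By the divergence
theorem the integral of \<open>div F\<close> over \<open>\<Omega>\<close> is zero, so both summands vanish identically, \<open>g + f\<close> is
constant, and the body is symmetric.

Four ingredients carry this argument. The lemma \<open>real_analytic_on_imp_C2\<close> extracts from the convergent
power series a defining function with a continuous symmetric Hessian. The lemma
\<open>sum_eigenvalues_with_multiplicity\<close>, together with \<open>trace_orthonormal_basis\<close>, turns the sum of the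
principal curvatures into a trace, which \<open>mean_curvature_eq_divergence\<close> identifies with a divergence.
The lemma \<open>divergence_zero_of_nonneg\<close> replaces the divergence theorem on \<open>\<Omega>\<close> by a cutoff argument that
sees only the volume of boundary layers. Finally \<open>normals_merge_at_boundary\<close> provides the boundary behaviour.\<close>

section \<open>Real analytic functions are twice continuously differentiable\<close>

text \<open>Weierstrass' criterion for unordered sums: an enumeration of the index set reduces it to the theorem for
series, where the tails of \<open>K\<close> bound the tails of the derivatives uniformly.\<close>

lemma has_derivative_has_sum:
  fixes f :: "'i \<Rightarrow> 'a::real_normed_vector \<Rightarrow> real"
  assumes I: "countable I" "infinite I" and S: "open S" "convex S"
    and der: "\<And>i x. i \<in> I \<Longrightarrow> x \<in> S \<Longrightarrow> (f i has_derivative f' i x) (at x)"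
    and bound: "\<And>i x h. i \<in> I \<Longrightarrow> x \<in> S \<Longrightarrow> \<bar>f' i x h\<bar> \<le> K i * norm h"
    and K: "K summable_on I"
    and sum: "\<And>x. x \<in> S \<Longrightarrow> ((\<lambda>i. f i x) has_sum F x) I"
    and sum': "\<And>x h. x \<in> S \<Longrightarrow> ((\<lambda>i. f' i x h) has_sum F' x h) I"
    and x: "x \<in> S"
  shows "(F has_derivative F' x) (at x)"
proof -
  define e where "e = from_nat_into I"
  have e: "bij_betw e UNIV I" unfolding e_def by (rule bij_betw_from_nat_into[OF I])
  have eI: "e n \<in> I" for n using e by (auto simp: bij_betw_def)
  have sums: "(\<lambda>n. g (e n)) sums l" if "(g has_sum l) I" for g :: "'i \<Rightarrow> real" and l
    using that has_sum_reindex_bij_betw[OF e] has_sum_imp_sums by blast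
  obtain k where k: "(K has_sum k) I" using K by (auto simp: summable_on_def)
  define T where "T n = k - (\<Sum>i<n. K (e i))" for n
  have "T \<longlonglongrightarrow> 0"
    unfolding T_def using tendsto_diff[OF tendsto_const sums[OF k, unfolded sums_def], of k] by simp
  have tail: "norm ((\<Sum>i<n. f' (e i) y h) - F' y h) \<le> T n * norm h" if y: "y \<in> S" for n y h
  proof -
    have "(\<lambda>i. f' (e (i + n)) y h) sums (F' y h - (\<Sum>i<n. f' (e i) y h))"
      by (rule sums_split_initial_segment[OF sums[OF sum'[OF y]]])
    moreover have "(\<lambda>i. K (e (i + n)) * norm h) sums (T n * norm h)"
      unfolding T_def by (intro sums_mult2 sums_split_initial_segment sums k)
    moreover have "norm (f' (e (i + n)) y h) \<le> K (e (i + n)) * norm h" for i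
      using bound[OF eI y] by simp
    ultimately have "norm (F' y h - (\<Sum>i<n. f' (e i) y h)) \<le> T n * norm h"
      using norm_sums_le by blast
    then show ?thesis by (simp add: norm_minus_commute)
  qed
  have "\<exists>g. \<forall>y\<in>S. (\<lambda>n. f (e n) y) sums g y \<and> (g has_derivative F' y) (at y within S)"
  proof (rule has_derivative_series[where f'="\<lambda>n. f' (e n)"])
    show "\<forall>\<^sub>F n in sequentially. \<forall>y\<in>S. \<forall>h. norm ((\<Sum>i<n. f' (e i) y h) - F' y h) \<le> \<epsilon> * norm h"
      if "\<epsilon> > 0" for \<epsilon>
      using order_tendstoD(2)[OF \<open>T \<longlonglongrightarrow> 0\<close> that]
    proof eventually_elim
      case (elim n)
      show ?case
      proof (intro ballI allI)
        fix y and h :: 'a assume "y \<in> S"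
        have "T n * norm h \<le> \<epsilon> * norm h" using elim by (intro mult_right_mono) auto
        then show "norm ((\<Sum>i<n. f' (e i) y h) - F' y h) \<le> \<epsilon> * norm h"
          using tail[OF \<open>y \<in> S\<close>, where n=n and h=h] by linarith
      qed
    qed
    show "(\<lambda>n. f (e n) x) sums F x" by (rule sums[OF sum[OF x]])
  qed (use S x der eI in \<open>auto intro: has_derivative_at_withinI\<close>)
  then obtain g where g: "\<And>y. y \<in> S \<Longrightarrow> (\<lambda>n. f (e n) y) sums g y"
    "\<And>y. y \<in> S \<Longrightarrow> (g has_derivative F' y) (at y within S)" by blast
  have eq: "g y = F y" if "y \<in> S" for y
    using sums_unique2[OF g(1)[OF that] sums[OF sum[OF that]]] .
  have "(g has_derivative F' x) (at x)" using g(2)[OF x] unfolding at_within_open[OF x S(1)] .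
  then show ?thesis by (rule has_derivative_transform_within_open[OF _ S(1) x eq])
qed

lemma summable_on_abs_iff:
  fixes f :: "'i \<Rightarrow> real"
  shows "(\<lambda>x. \<bar>f x\<bar>) summable_on A \<longleftrightarrow> f summable_on A"
  unfolding summable_on_iff_abs_summable_on_real[of f A] by simp

lemma has_sum_finite_sum:
  fixes f :: "'j \<Rightarrow> 'i \<Rightarrow> real"
  assumes "finite J" "\<And>j. j \<in> J \<Longrightarrow> (f j has_sum l j) A"
  shows "((\<lambda>x. \<Sum>j\<in>J. f j x) has_sum (\<Sum>j\<in>J. l j)) A"
  using assms by (induction J rule: finite_induct) (auto intro!: has_sum_add)

text \<open>Power series in several variables are treated by their coefficient families \<open>c\<close>. Convergence at polyradius
\<open>s\<close> means absolute convergence at the corner \<open>(s, \<dots>, s)\<close> of a cube. The point is that this class is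
closed under partial differentiation, at the price of halving \<open>s\<close>; so second derivatives and their
continuity come from using the same lemma three times.\<close>

definition monom_at :: "('a::euclidean_space \<Rightarrow> nat) \<Rightarrow> 'a \<Rightarrow> real" where
  "monom_at \<alpha> z = (\<Prod>b\<in>Basis. (z \<bullet> b) ^ \<alpha> b)"

definition polyradius_weight :: "real \<Rightarrow> ('a::euclidean_space \<Rightarrow> nat) \<Rightarrow> real" where
  "polyradius_weight s \<alpha> = (\<Prod>b\<in>(Basis::'a set). s ^ \<alpha> b)"

abbreviation multi_indices :: "('a::euclidean_space \<Rightarrow> nat) set" where
  "multi_indices \<equiv> Basis \<rightarrow>\<^sub>E UNIV"

definition converges_at :: "real \<Rightarrow> (('a::euclidean_space \<Rightarrow> nat) \<Rightarrow> real) \<Rightarrow> bool" where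
  "converges_at s c \<longleftrightarrow> ((\<lambda>\<alpha>. \<bar>c \<alpha> * polyradius_weight s \<alpha>\<bar>) summable_on multi_indices)"

definition pseries :: "'a::euclidean_space \<Rightarrow> (('a \<Rightarrow> nat) \<Rightarrow> real) \<Rightarrow> 'a \<Rightarrow> real" where
  "pseries p c x = (\<Sum>\<^sub>\<infinity>\<alpha>\<in>multi_indices. c \<alpha> * monom_at \<alpha> (x - p))"

definition partial_coeff :: "'a::euclidean_space \<Rightarrow> (('a \<Rightarrow> nat) \<Rightarrow> real) \<Rightarrow> ('a \<Rightarrow> nat) \<Rightarrow> real" where
  "partial_coeff b c \<beta> = real (\<beta> b + 1) * c (\<beta>(b := \<beta> b + 1))"

text \<open>This identity of coefficients is where the symmetry of the Hessian comes from.\<close>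

lemma partial_coeff_commute: "partial_coeff a (partial_coeff b c) = partial_coeff b (partial_coeff a c)"
  by (cases "a = b") (auto simp: partial_coeff_def fun_eq_iff fun_upd_twist)

lemma countable_multi_indices: "countable (multi_indices :: ('a::euclidean_space \<Rightarrow> nat) set)"
  by (intro countable_PiE) auto

lemma infinite_multi_indices: "infinite (multi_indices :: ('a::euclidean_space \<Rightarrow> nat) set)"
proof
  assume fin: "finite (multi_indices :: ('a \<Rightarrow> nat) set)"
  let ?f = "\<lambda>k. restrict (\<lambda>_. k) (Basis :: 'a set) :: 'a \<Rightarrow> nat"
  obtain b :: 'a where b: "b \<in> Basis" using nonempty_Basis by blast
  have "inj ?f" using b by (auto simp: inj_on_def fun_eq_iff restrict_def)
  moreover have "range ?f \<subseteq> multi_indices" by auto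
  ultimately show False using fin finite_imageD finite_subset infinite_UNIV_nat by metis
qed

lemma monom_at_upd:
  assumes "b \<in> Basis"
  shows "monom_at (\<alpha>(b := k)) z = (z \<bullet> b) ^ k * (\<Prod>a\<in>Basis - {b}. (z \<bullet> a) ^ \<alpha> a)"
  unfolding monom_at_def using assms by (subst prod.remove[of _ b]) (auto intro!: prod.cong)

lemma polyradius_weight_upd:
  fixes b :: "'a::euclidean_space"
  assumes "b \<in> Basis"
  shows "polyradius_weight s (\<alpha>(b := k)) = s ^ k * (\<Prod>a\<in>Basis - {b}. s ^ \<alpha> a)"
  unfolding polyradius_weight_def using assms by (subst prod.remove[of _ b]) (auto intro!: prod.cong)

lemma monom_at_bound:
  assumes "norm z \<le> s"
  shows "\<bar>monom_at \<alpha> z\<bar> \<le> polyradius_weight s \<alpha>"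
  unfolding monom_at_def polyradius_weight_def abs_prod power_abs
  using assms Basis_le_norm by (intro prod_mono conjI power_mono) (auto intro: order_trans)

text \<open>The factor \<open>\<alpha> b\<close> produced by differentiation is absorbed by halving the radius, since
\<open>k \<le> 2\<^sup>k\<close>.\<close>

lemma polyradius_weight_half:
  fixes b :: "'a::euclidean_space"
  assumes b: "b \<in> Basis" and s: "s > 0"
  shows "real (\<alpha> b) * polyradius_weight (s / 2) (\<alpha>(b := \<alpha> b - 1)) \<le> 2 / s * polyradius_weight s \<alpha>"
proof -
  have w: "polyradius_weight s \<alpha> = s ^ \<alpha> b * (\<Prod>a\<in>Basis - {b}. s ^ \<alpha> a)"
    using polyradius_weight_upd[OF b, of s \<alpha> "\<alpha> b"] by simp
  have "real n * (s / 2) ^ (n - 1) \<le> 2 / s * s ^ n" for n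
  proof (cases n)
    case (Suc m)
    have "real (Suc m) \<le> real (2 ^ Suc m)" using less_exp[of "Suc m"] of_nat_le_iff less_imp_le by blast
    then have "real (Suc m) * s ^ m \<le> 2 * 2 ^ m * s ^ m" using s by (intro mult_right_mono) auto
    then show ?thesis using Suc s by (simp add: power_divide field_simps)
  qed (use s in simp)
  moreover have "(\<Prod>a\<in>Basis - {b}. (s / 2) ^ \<alpha> a) \<le> (\<Prod>a\<in>Basis - {b}. s ^ \<alpha> a)"
    using s by (intro prod_mono conjI power_mono) auto
  ultimately have "(real (\<alpha> b) * (s / 2) ^ (\<alpha> b - 1)) * (\<Prod>a\<in>Basis - {b}. (s / 2) ^ \<alpha> a)
      \<le> (2 / s * s ^ \<alpha> b) * (\<Prod>a\<in>Basis - {b}. s ^ \<alpha> a)"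
    using s by (intro mult_mono[OF _ _ _ prod_nonneg]) auto
  then show ?thesis by (simp add: w polyradius_weight_upd[OF b] mult.assoc)
qed

lemma polyradius_weight_nonneg: "s \<ge> 0 \<Longrightarrow> 0 \<le> polyradius_weight s \<alpha>"
  by (auto simp: polyradius_weight_def intro!: prod_nonneg)

lemma pseries_has_sum:
  fixes c :: "('a::euclidean_space \<Rightarrow> nat) \<Rightarrow> real"
  assumes "converges_at s c" "norm (x - p) \<le> s"
  shows "((\<lambda>\<alpha>. c \<alpha> * monom_at \<alpha> (x - p)) has_sum pseries p c x) multi_indices"
proof -
  have "s \<ge> 0" using assms(2) norm_ge_zero order_trans by blast
  then have "(\<lambda>\<alpha>. \<bar>c \<alpha> * monom_at \<alpha> (x - p)\<bar>) summable_on multi_indices"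
    using assms(1) monom_at_bound[OF assms(2)] polyradius_weight_nonneg[of s] unfolding converges_at_def
    by (elim summable_on_comparison_test) (simp_all add: abs_mult mult_left_mono polyradius_weight_nonneg)
  then have "(\<lambda>\<alpha>. c \<alpha> * monom_at \<alpha> (x - p)) summable_on multi_indices"
    by (simp add: summable_on_abs_iff)
  then show ?thesis unfolding pseries_def by (rule has_sum_infsum)
qed

text \<open>The index shift between a series differentiated termwise and the series with coefficients \<open>partial_coeff\<close>:
the indices outside the range of the shift are those at which the differentiated term vanishes.\<close>

lemma
  fixes b :: "'a::euclidean_space" and g :: "('a \<Rightarrow> nat) \<Rightarrow> real"
  assumes b: "b \<in> Basis"
  shows inj_raise_index: "inj_on (\<lambda>\<beta>. \<beta>(b := \<beta> b + 1)) multi_indices"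
    and raise_index_subset: "(\<lambda>\<beta>. \<beta>(b := \<beta> b + 1)) ` multi_indices \<subseteq> multi_indices"
    and has_sum_raise_index: "(\<And>\<alpha>. \<alpha> \<in> multi_indices \<Longrightarrow> \<alpha> b = 0 \<Longrightarrow> g \<alpha> = 0) \<Longrightarrow>
       ((\<lambda>\<beta>. g (\<beta>(b := \<beta> b + 1))) has_sum l) multi_indices \<Longrightarrow> (g has_sum l) multi_indices"
proof -
  let ?h = "\<lambda>\<beta>. \<beta>(b := \<beta> b + 1) :: 'a \<Rightarrow> nat"
  have "(?h \<beta>)(b := ?h \<beta> b - 1) = \<beta>" for \<beta> by simp
  then show inj: "inj_on ?h multi_indices" by (intro inj_on_inverseI)
  show sub: "?h ` multi_indices \<subseteq> multi_indices" using b by (auto simp: PiE_iff extensional_def)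
  assume g0: "\<And>\<alpha>. \<alpha> \<in> multi_indices \<Longrightarrow> \<alpha> b = 0 \<Longrightarrow> g \<alpha> = 0"
    and l: "((\<lambda>\<beta>. g (\<beta>(b := \<beta> b + 1))) has_sum l) multi_indices"
  have "\<alpha> \<in> ?h ` multi_indices" if "\<alpha> \<in> multi_indices" "\<alpha> b \<noteq> 0" for \<alpha>
  proof
    show "\<alpha> = ?h (\<alpha>(b := \<alpha> b - 1))" using that by auto
    show "\<alpha>(b := \<alpha> b - 1) \<in> multi_indices" using that b by (auto simp: PiE_iff extensional_def)
  qed
  then have "g \<alpha> = 0" if "\<alpha> \<in> multi_indices - ?h ` multi_indices" for \<alpha> using g0 that by blast
  moreover have "(g has_sum l) (?h ` multi_indices)"
    using l has_sum_reindex[OF inj, of g l] by (simp add: o_def)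
  ultimately show "(g has_sum l) multi_indices"
    using has_sum_cong_neutral[of multi_indices "?h ` multi_indices" g g l] sub by blast
qed

lemma converges_at_partial:
  fixes c :: "('a::euclidean_space \<Rightarrow> nat) \<Rightarrow> real"
  assumes c: "converges_at s c" and s: "s > 0" and b: "b \<in> Basis"
  shows "converges_at (s / 2) (partial_coeff b c)"
proof -
  let ?h = "\<lambda>\<beta>. \<beta>(b := \<beta> b + 1) :: 'a \<Rightarrow> nat"
  let ?g = "\<lambda>\<alpha>. c \<alpha> * (real (\<alpha> b) * polyradius_weight (s / 2) (\<alpha>(b := \<alpha> b - 1)))"
  have "(\<lambda>\<alpha>. \<bar>c \<alpha> * polyradius_weight s \<alpha>\<bar> * \<bar>2 / s\<bar>) summable_on multi_indices"
    using c unfolding converges_at_def by (rule summable_on_cmult_left)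
  then have "(\<lambda>\<alpha>. \<bar>?g \<alpha>\<bar>) summable_on multi_indices"
  proof (rule summable_on_comparison_test)
    fix \<alpha> :: "'a \<Rightarrow> nat"
    have "\<bar>real (\<alpha> b) * polyradius_weight (s / 2) (\<alpha>(b := \<alpha> b - 1))\<bar> \<le> 2 / s * polyradius_weight s \<alpha>"
      using polyradius_weight_half[OF b s, of \<alpha>] polyradius_weight_nonneg[of "s / 2"] s
      by (simp add: abs_mult polyradius_weight_nonneg)
    then have "\<bar>c \<alpha>\<bar> * \<bar>real (\<alpha> b) * polyradius_weight (s / 2) (\<alpha>(b := \<alpha> b - 1))\<bar>
        \<le> \<bar>c \<alpha>\<bar> * (2 / s * polyradius_weight s \<alpha>)"
      by (rule mult_left_mono) simp
    also have "\<dots> = \<bar>c \<alpha> * polyradius_weight s \<alpha>\<bar> * \<bar>2 / s\<bar>"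
      using s by (simp add: abs_mult polyradius_weight_nonneg)
    finally show "\<bar>?g \<alpha>\<bar> \<le> \<bar>c \<alpha> * polyradius_weight s \<alpha>\<bar> * \<bar>2 / s\<bar>"
      unfolding abs_mult .
  qed auto
  then have "(\<lambda>\<alpha>. \<bar>?g \<alpha>\<bar>) summable_on (?h ` multi_indices)"
    using raise_index_subset[OF b] by (rule summable_on_subset_banach)
  then have "(\<lambda>\<beta>. \<bar>?g (?h \<beta>)\<bar>) summable_on multi_indices"
    unfolding summable_on_reindex[OF inj_raise_index[OF b]] by (simp add: o_def)
  then show ?thesis
    unfolding converges_at_def partial_coeff_def by (simp add: mult_ac)
qed

lemma monom_at_has_derivative:
  "((\<lambda>x. monom_at \<alpha> (x - p)) has_derivative
    (\<lambda>h. \<Sum>b\<in>Basis. (h \<bullet> b) * (real (\<alpha> b) * monom_at (\<alpha>(b := \<alpha> b - 1)) (x - p)))) (at x)"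
proof -
  have "((\<lambda>x. \<Prod>b\<in>Basis. ((x - p) \<bullet> b) ^ \<alpha> b) has_derivative
      (\<lambda>h. \<Sum>b\<in>Basis. (real (\<alpha> b) * (h \<bullet> b) * ((x - p) \<bullet> b) ^ (\<alpha> b - 1))
          * (\<Prod>a\<in>Basis - {b}. ((x - p) \<bullet> a) ^ \<alpha> a))) (at x)"
    by (intro has_derivative_prod has_derivative_power) (auto intro!: derivative_eq_intros)
  also have "(\<lambda>h. \<Sum>b\<in>Basis. (real (\<alpha> b) * (h \<bullet> b) * ((x - p) \<bullet> b) ^ (\<alpha> b - 1))
          * (\<Prod>a\<in>Basis - {b}. ((x - p) \<bullet> a) ^ \<alpha> a)) =
     (\<lambda>h. \<Sum>b\<in>Basis. (h \<bullet> b) * (real (\<alpha> b) * monom_at (\<alpha>(b := \<alpha> b - 1)) (x - p)))"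
    by (intro ext sum.cong refl) (simp add: monom_at_upd mult_ac)
  finally show ?thesis unfolding monom_at_def .
qed

lemma pseries_has_derivative:
  fixes c :: "('a::euclidean_space \<Rightarrow> nat) \<Rightarrow> real"
  assumes c: "converges_at s c" and s: "s > 0" and x: "x \<in> ball p (s / 2)"
  shows "(pseries p c has_derivative (\<lambda>h. \<Sum>b\<in>Basis. (h \<bullet> b) * pseries p (partial_coeff b c) x)) (at x)"
proof -
  let ?t = "\<lambda>\<alpha> b x. real (\<alpha> b) * monom_at (\<alpha>(b := \<alpha> b - 1)) (x - p)"
  have nx: "norm (x - p) \<le> s / 2" if "x \<in> ball p (s / 2)" for x
    using that by (simp add: dist_norm norm_minus_commute)
  have der: "((\<lambda>x. c \<alpha> * monom_at \<alpha> (x - p)) has_derivative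
      (\<lambda>h. c \<alpha> * (\<Sum>b\<in>Basis. (h \<bullet> b) * ?t \<alpha> b x))) (at x)" for \<alpha> x
    by (intro has_derivative_mult_right monom_at_has_derivative)
  have bound: "\<bar>c \<alpha> * (\<Sum>b\<in>Basis. (h \<bullet> b) * ?t \<alpha> b x)\<bar>
      \<le> (\<bar>c \<alpha> * polyradius_weight s \<alpha>\<bar> * (real DIM('a) * (2 / s))) * norm h"
    if "x \<in> ball p (s / 2)" for \<alpha> x h
  proof -
    have "\<bar>(h \<bullet> b) * ?t \<alpha> b x\<bar> \<le> norm h * (2 / s * polyradius_weight s \<alpha>)" if b: "b \<in> Basis" for b
      unfolding abs_mult
    proof (rule mult_mono)
      show "\<bar>h \<bullet> b\<bar> \<le> norm h" by (rule Basis_le_norm[OF b])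
      have "\<bar>real (\<alpha> b)\<bar> * \<bar>monom_at (\<alpha>(b := \<alpha> b - 1)) (x - p)\<bar>
          \<le> real (\<alpha> b) * polyradius_weight (s / 2) (\<alpha>(b := \<alpha> b - 1))"
        using monom_at_bound[OF nx[OF \<open>x \<in> ball p (s / 2)\<close>]] by (simp add: mult_left_mono)
      then show "\<bar>real (\<alpha> b)\<bar> * \<bar>monom_at (\<alpha>(b := \<alpha> b - 1)) (x - p)\<bar> \<le> 2 / s * polyradius_weight s \<alpha>"
        using polyradius_weight_half[OF b s, of \<alpha>] by linarith
    qed auto
    then have "\<bar>\<Sum>b\<in>Basis. (h \<bullet> b) * ?t \<alpha> b x\<bar> \<le> real DIM('a) * (norm h * (2 / s * polyradius_weight s \<alpha>))"
      by (intro order_trans[OF sum_abs] sum_bounded_above)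
    then have "\<bar>c \<alpha>\<bar> * \<bar>\<Sum>b\<in>Basis. (h \<bullet> b) * ?t \<alpha> b x\<bar>
        \<le> \<bar>c \<alpha>\<bar> * (real DIM('a) * (norm h * (2 / s * polyradius_weight s \<alpha>)))"
      by (intro mult_left_mono) auto
    then show ?thesis
      using polyradius_weight_nonneg[of s \<alpha>] s by (simp add: abs_mult mult_ac)
  qed
  have K: "(\<lambda>\<alpha>. \<bar>c \<alpha> * polyradius_weight s \<alpha>\<bar> * (real DIM('a) * (2 / s))) summable_on multi_indices"
    using c unfolding converges_at_def real_norm_def by (rule summable_on_cmult_left)
  have sum: "((\<lambda>\<alpha>. c \<alpha> * monom_at \<alpha> (x - p)) has_sum pseries p c x) multi_indices"
    if "x \<in> ball p (s / 2)" for x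
    using pseries_has_sum[OF c, of x p] nx[OF that] s by simp
  have sum': "((\<lambda>\<alpha>. c \<alpha> * (\<Sum>b\<in>Basis. (h \<bullet> b) * ?t \<alpha> b x)) has_sum
      (\<Sum>b\<in>Basis. (h \<bullet> b) * pseries p (partial_coeff b c) x)) multi_indices"
    if "x \<in> ball p (s / 2)" for x h
  proof -
    have "((\<lambda>\<alpha>. c \<alpha> * ?t \<alpha> b x) has_sum pseries p (partial_coeff b c) x) multi_indices"
      if b: "b \<in> Basis" for b
    proof (rule has_sum_raise_index[OF b])
      show "((\<lambda>\<beta>. c (\<beta>(b := \<beta> b + 1)) * ?t (\<beta>(b := \<beta> b + 1)) b x)
          has_sum pseries p (partial_coeff b c) x) multi_indices"
        using pseries_has_sum[OF converges_at_partial[OF c s b] nx[OF \<open>x \<in> ball p (s / 2)\<close>]]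
        by (simp add: partial_coeff_def mult_ac)
    qed simp
    then have "((\<lambda>\<alpha>. \<Sum>b\<in>Basis. (h \<bullet> b) * (c \<alpha> * ?t \<alpha> b x)) has_sum
      (\<Sum>b\<in>Basis. (h \<bullet> b) * pseries p (partial_coeff b c) x)) multi_indices"
      by (intro has_sum_finite_sum has_sum_cmult_right) auto
    then show ?thesis by (simp add: sum_distrib_left mult_ac)
  qed
  show ?thesis
    by (rule has_derivative_has_sum[OF countable_multi_indices infinite_multi_indices open_ball convex_ball
        der bound K sum sum' x])
qed

definition gradient_hessian_on ::
    "('a::euclidean_space \<Rightarrow> real) \<Rightarrow> ('a \<Rightarrow> 'a) \<Rightarrow> ('a \<Rightarrow> 'a \<Rightarrow> 'a) \<Rightarrow> 'a set \<Rightarrow> bool" where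
  "gradient_hessian_on f A B S \<longleftrightarrow>
     (\<forall>x\<in>S. (f has_derivative (\<lambda>h. A x \<bullet> h)) (at x) \<and> (A has_derivative B x) (at x) \<and>
        (\<forall>u v. B x u \<bullet> v = u \<bullet> B x v)) \<and>
     (\<forall>k. continuous_on S (\<lambda>x. B x k))"

lemma real_analytic_on_imp_C2:
  fixes f :: "'a::euclidean_space \<Rightarrow> real"
  assumes "real_analytic_on f U" "p \<in> U"
  shows "\<exists>\<delta>>0. \<exists>A B. gradient_hessian_on f A B (ball p \<delta>)"
proof -
  have "\<exists>r>0. \<exists>c. \<forall>x\<in>ball p r. ((\<lambda>\<alpha>. c \<alpha> * monom_at \<alpha> (x - p)) has_sum f x) multi_indices"
    unfolding monom_at_def using assms(1)[unfolded real_analytic_on_def] assms(2) by (rule bspec)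
  then obtain r c where r: "r > 0"
    and hs0: "\<forall>x\<in>ball p r. ((\<lambda>\<alpha>. c \<alpha> * monom_at \<alpha> (x - p)) has_sum f x) multi_indices"
    by (elim exE conjE) (rule that)
  have hs: "((\<lambda>\<alpha>. c \<alpha> * monom_at \<alpha> (x - p)) has_sum f x) multi_indices" if "x \<in> ball p r" for x
    using hs0 that by (rule bspec)
  define s where "s = r / (real DIM('a) + 1)"
  have s: "s > 0" "s * real DIM('a) < r" "s \<le> r" using r by (auto simp: s_def field_simps)
  \<comment> \<open>at this corner of a cube the series has the terms \<open>c \<alpha> s\<^bsup>\<bar>\<alpha>\<bar>\<^esup>\<close>\<close>
  define x1 where "x1 = p + s *\<^sub>R (\<Sum>b\<in>Basis. b)"
  have "norm (\<Sum>b\<in>(Basis::'a set). b) \<le> real DIM('a)"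
    using sum_norm_le[of Basis "\<lambda>b. b" "\<lambda>_::'a. 1::real"] by simp
  then have "norm (x1 - p) \<le> s * real DIM('a)" using s by (simp add: x1_def)
  then have "x1 \<in> ball p r" using s by (simp add: dist_norm norm_minus_commute)
  from has_sum_imp_summable[OF hs[OF this]] have "(\<lambda>\<alpha>. \<bar>c \<alpha> * monom_at \<alpha> (x1 - p)\<bar>) summable_on multi_indices"
    by (simp add: summable_on_abs_iff)
  moreover have "monom_at \<alpha> (x1 - p) = polyradius_weight s \<alpha>" for \<alpha>
    unfolding monom_at_def polyradius_weight_def
    by (intro prod.cong refl) (simp add: x1_def inner_sum_left inner_Basis)
  ultimately have c: "converges_at s c" by (simp add: converges_at_def)
  have c1: "converges_at (s / 2) (partial_coeff b c)" if "b \<in> Basis" for b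
    by (rule converges_at_partial[OF c s(1) that])
  have c2: "converges_at (s / 4) (partial_coeff a (partial_coeff b c))" if "a \<in> Basis" "b \<in> Basis" for a b
    using converges_at_partial[OF c1[OF that(2)] _ that(1)] s(1) by simp
  define A where "A x = (\<Sum>b\<in>Basis. pseries p (partial_coeff b c) x *\<^sub>R b)" for x
  define B where "B x k = (\<Sum>b\<in>Basis. (\<Sum>a\<in>Basis. (k \<bullet> a) * pseries p (partial_coeff a (partial_coeff b c)) x) *\<^sub>R b)"
    for x k
  have in_ball: "x \<in> ball p r" "x \<in> ball p (s / 2)" "x \<in> ball p (s / 2 / 2)" "x \<in> ball p (s / 4 / 2)"
    if "x \<in> ball p (s / 8)" for x
    using that s by auto
  have "gradient_hessian_on f A B (ball p (s / 8))"
    unfolding gradient_hessian_on_def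
  proof (intro conjI ballI allI)
    fix x assume x: "x \<in> ball p (s / 8)"
    have eq: "pseries p c y = f y" if "y \<in> ball p r" for y
      using infsumI[OF hs[OF that]] by (simp add: pseries_def)
    have "(pseries p c has_derivative (\<lambda>h. A x \<bullet> h)) (at x)"
      using pseries_has_derivative[OF c s(1) in_ball(2)[OF x]]
      by (simp add: A_def inner_sum_left inner_sum_right mult.commute inner_commute)
    then show "(f has_derivative (\<lambda>h. A x \<bullet> h)) (at x)"
      by (rule has_derivative_transform_within_open[OF _ open_ball in_ball(1)[OF x] eq])
    show "(A has_derivative B x) (at x)"
      unfolding A_def[abs_def] B_def using s
      by (intro has_derivative_sum has_derivative_scaleR_left pseries_has_derivative[where s="s / 2"] c1 in_ball x) auto
    fix u v
    show "B x u \<bullet> v = u \<bullet> B x v"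
    proof -
      have "B x u \<bullet> v = (\<Sum>b\<in>Basis. \<Sum>a\<in>Basis. (u \<bullet> a) * (v \<bullet> b) * pseries p (partial_coeff a (partial_coeff b c)) x)"
        by (simp add: B_def inner_sum_left inner_sum_right sum_distrib_left sum_distrib_right mult_ac inner_commute)
      also have "\<dots> = (\<Sum>a\<in>Basis. \<Sum>b\<in>Basis. (u \<bullet> a) * (v \<bullet> b) * pseries p (partial_coeff b (partial_coeff a c)) x)"
        by (subst sum.swap) (simp add: partial_coeff_commute)
      also have "\<dots> = u \<bullet> B x v"
        by (simp add: B_def inner_sum_left inner_sum_right sum_distrib_left sum_distrib_right mult_ac inner_commute)
      finally show ?thesis .
    qed
  next
    fix k
    have cP: "continuous_on (ball p (s / 8)) (pseries p (partial_coeff a (partial_coeff b c)))"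
      if "a \<in> Basis" "b \<in> Basis" for a b
    proof (intro continuous_at_imp_continuous_on ballI)
      fix x assume "x \<in> ball p (s / 8)"
      then show "isCont (pseries p (partial_coeff a (partial_coeff b c))) x"
        using has_derivative_continuous[OF pseries_has_derivative[OF c2[OF that] _ in_ball(4)]] s by simp
    qed
    show "continuous_on (ball p (s / 8)) (\<lambda>x. B x k)"
      unfolding B_def by (intro continuous_on_sum continuous_on_scaleR continuous_on_mult continuous_on_const cP)
  qed
  moreover have "s / 8 > 0" using s by simp
  ultimately show ?thesis by blast
qed

section \<open>The sum of the eigenvalues of a symmetric operator\<close>

text \<open>The spectral theorem, in the form needed for a shape operator that acts on a hyperplane only: a maximizer of
the Rayleigh quotient on the unit sphere of the invariant subspace \<open>S\<close> is an eigenvector, and its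
orthogonal complement in \<open>S\<close> is invariant again.\<close>

lemma symmetric_orthonormal_eigenbasis:
  fixes L :: "'a::euclidean_space \<Rightarrow> 'a"
  assumes lin: "linear L" and S: "subspace S"
    and inv: "\<And>v. v \<in> S \<Longrightarrow> L v \<in> S"
    and sym: "\<And>v w. v \<in> S \<Longrightarrow> w \<in> S \<Longrightarrow> L v \<bullet> w = v \<bullet> L w"
  shows "\<exists>E. E \<subseteq> S \<and> pairwise orthogonal E \<and>
             (\<forall>e\<in>E. norm e = 1 \<and> (\<exists>k. L e = k *\<^sub>R e)) \<and> span E = S"
  using S inv sym
proof (induction "dim S" arbitrary: S rule: less_induct)
  case less
  note S = less.prems(1) and inv = less.prems(2) and sym = less.prems(3)
  show ?case
  proof (cases "S = {0}")
    case True
    then show ?thesis by (intro exI[of _ "{}"]) (auto simp: pairwise_def)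
  next
    case False
    then obtain x where x: "x \<in> S" "x \<noteq> 0" using subspace_0[OF S] by auto
    define Z where "Z = S \<inter> sphere 0 1"
    have "compact Z" unfolding Z_def
      by (intro closed_Int_compact closed_subspace S) auto
    moreover have "x /\<^sub>R norm x \<in> Z"
      using x S by (auto simp: Z_def subspace_scale)
    moreover have "continuous_on Z (\<lambda>v. v \<bullet> L v)"
      using lin by (intro continuous_intros linear_continuous_on) (auto simp: linear_conv_bounded_linear)
    ultimately obtain v where v: "v \<in> Z" and vmax: "\<And>w. w \<in> Z \<Longrightarrow> w \<bullet> L w \<le> v \<bullet> L v"
      using continuous_attains_sup[of Z "\<lambda>v. v \<bullet> L v"] by blast
    define k where "k = v \<bullet> L v"
    have vS: "v \<in> S" and nv: "norm v = 1" and vv: "v \<bullet> v = 1"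
      using v by (auto simp: Z_def dot_square_norm)
    have ray: "w \<bullet> L w \<le> k * (w \<bullet> w)" if "w \<in> S" for w
    proof (cases "w = 0")
      case False
      then have "w /\<^sub>R norm w \<in> Z"
        using that S by (auto simp: Z_def subspace_scale)
      from vmax[OF this] have "(w \<bullet> L w) / (norm w)^2 \<le> k"
        using lin by (simp add: linear_cmul k_def power2_eq_square divide_inverse mult_ac)
      then show ?thesis
        using False by (simp add: divide_le_eq dot_square_norm)
    qed (use lin in \<open>simp add: linear_0\<close>)
    define r where "r = L v - k *\<^sub>R v"
    have rS: "r \<in> S" unfolding r_def using vS inv S by (intro subspace_diff subspace_scale) auto
    have rv: "r \<bullet> v = 0" by (simp add: r_def inner_diff_left vv k_def inner_commute[of "L v" v])
    have rLv: "L r \<bullet> v = r \<bullet> r"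
      using sym[OF rS vS] rv by (simp add: r_def inner_diff_right inner_diff_left)
    \<comment> \<open>maximality of \<open>v\<close> along the line \<open>v + t r\<close>, where \<open>r\<close> is the defect of the eigenvalue equation\<close>
    have quad: "2 * t * (r \<bullet> r) \<le> t^2 * (k * (r \<bullet> r) - r \<bullet> L r)" for t :: real
    proof -
      have "v + t *\<^sub>R r \<in> S" using vS rS S by (intro subspace_add subspace_scale)
      from ray[OF this] have "(v + t *\<^sub>R r) \<bullet> L (v + t *\<^sub>R r) \<le> k * ((v + t *\<^sub>R r) \<bullet> (v + t *\<^sub>R r))" .
      moreover have "r \<bullet> L v = r \<bullet> r" using rv by (simp add: r_def inner_diff_right)
      moreover have "v \<bullet> L r = r \<bullet> r" using rLv by (simp add: inner_commute)
      moreover have "v \<bullet> r = 0" using rv by (simp add: inner_commute)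
      ultimately show ?thesis using rv vv lin
        by (simp add: linear_add linear_cmul inner_add_left inner_add_right k_def[symmetric]
            algebra_simps power2_eq_square)
    qed
    have "r \<bullet> r = 0"
    proof (rule ccontr)
      assume "r \<bullet> r \<noteq> 0"
      then have pos: "r \<bullet> r > 0" by auto
      define C where "C = \<bar>k * (r \<bullet> r) - r \<bullet> L r\<bar> + 1"
      define t where "t = (r \<bullet> r) / C"
      have C: "C > 0" by (simp add: C_def add_nonneg_pos)
      then have t: "t > 0" using pos by (simp add: t_def)
      have "t^2 * (k * (r \<bullet> r) - r \<bullet> L r) \<le> t^2 * C"
        by (intro mult_left_mono) (auto simp: C_def)
      also have "\<dots> = t * (r \<bullet> r)" using C by (simp add: t_def power2_eq_square)
      finally have "2 * t * (r \<bullet> r) \<le> t * (r \<bullet> r)" using quad[of t] by linarith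
      then show False using t pos by simp
    qed
    then have eig: "L v = k *\<^sub>R v" by (simp add: r_def)
    define S' where "S' = S \<inter> {w. v \<bullet> w = 0}"
    have S': "subspace S'" unfolding S'_def by (rule subspace_inter[OF S subspace_hyperplane])
    have "v \<notin> S'" using vv by (simp add: S'_def)
    moreover have "S' \<subseteq> S" by (auto simp: S'_def)
    ultimately have "S' \<subset> S" using vS by blast
    then have "dim S' < dim S"
      using S S' by (metis dim_psubset span_eq_iff)
    moreover have "L w \<in> S'" if "w \<in> S'" for w
      using that inv[of w] sym[of v w] vS eig by (auto simp: S'_def)
    ultimately obtain E where E: "E \<subseteq> S'" "pairwise orthogonal E"
      "\<forall>e\<in>E. norm e = 1 \<and> (\<exists>k. L e = k *\<^sub>R e)" "span E = S'"
      using less.hyps[of S'] S' sym by (metis Int_iff S'_def)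
    have "span (insert v E) = S"
    proof
      show "span (insert v E) \<subseteq> S"
        using E(1) vS S by (intro span_minimal) (auto simp: S'_def)
      show "S \<subseteq> span (insert v E)"
      proof
        fix w assume w: "w \<in> S"
        have "w - (v \<bullet> w) *\<^sub>R v \<in> span E"
          using w vS S vv by (auto simp: E(4) S'_def inner_diff_right intro!: subspace_diff subspace_scale)
        then show "w \<in> span (insert v E)" by (auto simp: span_insert)
      qed
    qed
    moreover have "pairwise orthogonal (insert v E)"
      using E(1,2) by (auto simp: pairwise_insert orthogonal_def S'_def inner_commute)
    ultimately show ?thesis
      using E(1,3) vS nv eig by (intro exI[of _ "insert v E"]) (auto simp: S'_def)
  qed
qed

lemma orthonormal_sum_inner:
  fixes E :: "'a::euclidean_space set"
  assumes orth: "pairwise orthogonal E" and norm: "\<And>e. e \<in> E \<Longrightarrow> norm e = 1"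
    and v: "v \<in> span E"
  shows "finite E" "(\<Sum>e\<in>E. (v \<bullet> e) *\<^sub>R e) = v"
proof -
  have "0 \<notin> E" using norm by force
  then show fin: "finite E"
    using orth pairwise_orthogonal_independent independent_bound_general by blast
  have *: "(\<Sum>e\<in>E. (w \<bullet> e) *\<^sub>R e) = w" if "w \<in> E" for w
  proof -
    have "(\<Sum>e\<in>E. (w \<bullet> e) *\<^sub>R e) = (\<Sum>e\<in>E. if e = w then w else 0)"
      using that orth norm[of w]
      by (intro sum.cong) (auto simp: pairwise_def orthogonal_def dot_square_norm)
    then show ?thesis using fin that by simp
  qed
  have "linear (\<lambda>v. \<Sum>e\<in>E. (v \<bullet> e) *\<^sub>R e)"
    by (intro linearI) (simp_all add: inner_add_left scaleR_add_left sum.distrib scaleR_sum_right)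
  then show "(\<Sum>e\<in>E. (v \<bullet> e) *\<^sub>R e) = v"
    using linear_eq_on_span[of "\<lambda>v. \<Sum>e\<in>E. (v \<bullet> e) *\<^sub>R e" id E v] * v by (auto simp: linear_ident id_def)
qed

lemma trace_orthonormal_basis:
  fixes L :: "'a::euclidean_space \<Rightarrow> 'a"
  assumes lin: "linear L" and orth: "pairwise orthogonal E" and norm: "\<And>e. e \<in> E \<Longrightarrow> norm e = 1"
    and span: "span E = UNIV"
  shows "(\<Sum>e\<in>E. L e \<bullet> e) = (\<Sum>b\<in>Basis. L b \<bullet> b)"
proof -
  note on = orthonormal_sum_inner[OF orth norm]
  have "(\<Sum>e\<in>E. L e \<bullet> e) = (\<Sum>e\<in>E. \<Sum>b\<in>Basis. (b \<bullet> e) * (L e \<bullet> b))"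
    by (intro sum.cong refl, subst euclidean_inner) (simp add: mult.commute inner_commute)
  also have "\<dots> = (\<Sum>b\<in>Basis. \<Sum>e\<in>E. (b \<bullet> e) * (L e \<bullet> b))" by (rule sum.swap)
  also have "\<dots> = (\<Sum>b\<in>Basis. L (\<Sum>e\<in>E. (b \<bullet> e) *\<^sub>R e) \<bullet> b)"
    using lin by (simp add: linear_sum linear_cmul inner_sum_left o_def)
  also have "\<dots> = (\<Sum>b\<in>Basis. L b \<bullet> b)"
    using span by (intro sum.cong refl) (simp add: on(2))
  finally show ?thesis .
qed

text \<open>Grouping an orthonormal eigenbasis by eigenvalue: the eigenspace of \<open>k\<close> is spanned by the basis vectors
with eigenvalue \<open>k\<close>, so its dimension counts them.\<close>

lemma sum_eigenvalues_with_multiplicity: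
  fixes L :: "'a::euclidean_space \<Rightarrow> 'a"
  assumes E: "pairwise orthogonal E" "\<And>e. e \<in> E \<Longrightarrow> norm e = 1" and lin: "linear L"
    and eig: "\<And>e. e \<in> E \<Longrightarrow> \<exists>k. L e = k *\<^sub>R e"
  defines "P \<equiv> \<lambda>k. {v \<in> span E. L v = k *\<^sub>R v}"
  shows "(\<Sum>k | \<exists>v\<in>P k. v \<noteq> 0. real (dim (P k)) * k) = (\<Sum>e\<in>E. L e \<bullet> e)"
proof -
  define l where "l e = L e \<bullet> e" for e
  have fin: "finite E" using orthonormal_sum_inner(1)[OF E] span_0 by blast
  have l: "L e = l e *\<^sub>R e" if "e \<in> E" for e
    using eig[OF that] E(2)[OF that] by (auto simp: l_def dot_square_norm)
  have P: "P k = span {e \<in> E. l e = k}" for k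
  proof
    have sub: "subspace (P k)"
      using lin unfolding P_def subspace_def
      by (auto simp: linear_0 linear_add linear_cmul span_add span_scale span_0 scaleR_add_right)
    show "span {e \<in> E. l e = k} \<subseteq> P k"
      using sub by (intro span_minimal) (auto simp: P_def l span_base)
    show "P k \<subseteq> span {e \<in> E. l e = k}"
    proof
      fix v assume v: "v \<in> P k"
      have vs: "v = (\<Sum>e\<in>E. (v \<bullet> e) *\<^sub>R e)"
        using v orthonormal_sum_inner(2)[OF E] by (simp add: P_def)
      have coeff: "v \<bullet> e = 0" if e: "e \<in> E" "l e \<noteq> k" for e
      proof -
        have dot: "(\<Sum>d\<in>E. c d *\<^sub>R d) \<bullet> e = c e" for c
        proof -
          have "(\<Sum>d\<in>E. c d *\<^sub>R d) \<bullet> e = (\<Sum>d\<in>E. if d = e then c e else 0)"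
            unfolding inner_sum_left using e(1) E
            by (intro sum.cong refl) (auto simp: pairwise_def orthogonal_def dot_square_norm)
          then show ?thesis using fin e by simp
        qed
        have "L v = (\<Sum>d\<in>E. (l d * (v \<bullet> d)) *\<^sub>R d)"
          by (subst vs) (use lin in \<open>simp add: linear_sum linear_cmul l o_def mult.commute\<close>)
        then have "L v \<bullet> e = l e * (v \<bullet> e)" using dot by simp
        moreover have "L v \<bullet> e = k * (v \<bullet> e)" using v by (simp add: P_def)
        ultimately show ?thesis using e by simp
      qed
      have "(v \<bullet> e) *\<^sub>R e \<in> span {e \<in> E. l e = k}" if "e \<in> E" for e
        using coeff[OF that] that by (cases "l e = k") (auto intro: span_base span_scale span_0)
      then show "v \<in> span {e \<in> E. l e = k}"
        by (subst vs) (intro span_sum)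
    qed
  qed
  have nz: "e \<noteq> 0" if "e \<in> E" for e using E(2)[OF that] by auto
  have dimP: "dim (P k) = card {e \<in> E. l e = k}" for k
  proof -
    have "independent {e \<in> E. l e = k}"
      using E(1) nz by (intro pairwise_orthogonal_independent) (auto simp: pairwise_def)
    then show ?thesis by (simp add: P dim_eq_card_independent)
  qed
  have "{k. \<exists>v\<in>P k. v \<noteq> 0} = l ` E"
  proof
    show "{k. \<exists>v\<in>P k. v \<noteq> 0} \<subseteq> l ` E"
    proof
      fix k assume "k \<in> {k. \<exists>v\<in>P k. v \<noteq> 0}"
      then obtain v where v: "v \<in> span {e \<in> E. l e = k}" "v \<noteq> 0" unfolding P by blast
      show "k \<in> l ` E"
      proof (rule ccontr)
        assume "k \<notin> l ` E"
        then have "{e \<in> E. l e = k} = {}" by blast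
        with v show False by simp
      qed
    qed
    show "l ` E \<subseteq> {k. \<exists>v\<in>P k. v \<noteq> 0}" using nz by (auto simp: P intro: span_base)
  qed
  then have "(\<Sum>k | \<exists>v\<in>P k. v \<noteq> 0. real (dim (P k)) * k) = (\<Sum>k\<in>l ` E. \<Sum>e\<in>{e \<in> E. l e = k}. l e)"
    by (simp add: dimP)
  also have "\<dots> = (\<Sum>e\<in>E. l e)" using fin by (rule sum.image_gen[symmetric])
  finally show ?thesis by (simp add: l_def)
qed

section \<open>A nonnegative divergence of a field vanishing at the boundary\<close>

lemma Compl_bounded_nonempty:
  fixes \<Omega> :: "'a::euclidean_space set"
  assumes "bounded \<Omega>"
  shows "- \<Omega> \<noteq> {}"
proof
  assume "- \<Omega> = {}"
  then have "\<Omega> = UNIV" by blast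
  with assms show False by simp
qed

lemma measure_lborel_affine_image:
  fixes S :: "'a::euclidean_space set"
  assumes c: "c > 0" and S: "open S"
  shows "measure lborel ((\<lambda>x. t + c *\<^sub>R x) ` S) = c ^ DIM('a) * measure lborel S"
proof -
  let ?f = "\<lambda>x::'a. t + c *\<^sub>R x"
  have "open (?f ` S)" using open_affinity[OF S, of c t] c by (simp add: add.commute)
  then have b: "?f ` S \<in> sets borel" by simp
  have "inj ?f" using c by (auto simp: inj_on_def)
  then have vi: "?f -` (?f ` S) = S" by (rule inj_vimage_image_eq)
  have "emeasure lborel (?f ` S) = emeasure (density (distr lborel borel ?f) (\<lambda>_. \<bar>c\<bar> ^ DIM('a))) (?f ` S)"
    using lborel_affine[of c t] c by simp
  also have "\<dots> = ennreal (\<bar>c\<bar> ^ DIM('a)) * emeasure (distr lborel borel ?f) (?f ` S)"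
    using b by (intro emeasure_density_const) simp
  also have "emeasure (distr lborel borel ?f) (?f ` S) = emeasure lborel S"
    using b by (subst emeasure_distr) (simp_all add: vi)
  finally show ?thesis using c by (simp add: measure_def enn2real_mult)
qed

lemma integral_lborel_translate:
  fixes f :: "'a::euclidean_space \<Rightarrow> real"
  assumes "integrable lborel f"
  shows "integrable lborel (\<lambda>x. f (a + x))" "(\<integral>x. f (a + x) \<partial>lborel) = integral\<^sup>L lborel f"
proof -
  have f: "f \<in> borel_measurable borel" using assms by auto
  have p: "(+) a \<in> lborel \<rightarrow>\<^sub>M borel" by simp
  show "integrable lborel (\<lambda>x. f (a + x))"
    using integrable_distr_eq[OF p f] assms by (simp add: lborel_distr_plus)
  show "(\<integral>x. f (a + x) \<partial>lborel) = integral\<^sup>L lborel f"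
    using integral_distr[OF p f] by (simp add: lborel_distr_plus)
qed

text \<open>For a convex set the layer of depth \<open>s\<close> along the boundary has volume of order \<open>s\<close>. Contracting
\<open>\<Omega>\<close> by the factor \<open>1 - q\<close> towards the centre of a ball of radius \<open>r\<close> in \<open>\<Omega>\<close> yields points of
distance at least \<open>q r\<close> from the complement, so the layer is contained in the difference of \<open>\<Omega>\<close> and its
contraction, whose volume Bernoulli's inequality bounds.\<close>

lemma boundary_layer_measure:
  fixes \<Omega> :: "'a::euclidean_space set"
  assumes opn: "open \<Omega>" and cvx: "convex \<Omega>" and bdd: "bounded \<Omega>" and ne: "\<Omega> \<noteq> {}"
  obtains C s0 where "s0 > 0" "C \<ge> 0"
    "\<And>s. 0 < s \<Longrightarrow> s \<le> s0 \<Longrightarrow> measure lborel {x\<in>\<Omega>. infdist x (- \<Omega>) \<le> s} \<le> C * s"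
proof -
  from ne obtain z where "z \<in> \<Omega>" by auto
  with opn obtain r where r: "r > 0" "ball z r \<subseteq> \<Omega>" by (auto simp: open_contains_ball)
  have UN: "- \<Omega> \<noteq> {}" by (rule Compl_bounded_nonempty[OF bdd])
  let ?m = "measure lborel \<Omega>"
  have emb: "emeasure lborel \<Omega> \<noteq> \<infinity>" using emeasure_bounded_finite[OF bdd] by simp
  have bound: "measure lborel {x\<in>\<Omega>. infdist x (- \<Omega>) \<le> s} \<le> (2 * real DIM('a) * ?m / r) * s"
    if s: "0 < s" "s \<le> r / 4" for s
  proof -
    define q where "q = 2 * s / r"
    have q: "0 < q" "q < 1" "s < q * r" using s r by (auto simp: q_def field_simps)
    define f where "f = (\<lambda>x. q *\<^sub>R z + (1 - q) *\<^sub>R x)"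
    have f_dist: "infdist (f y) (- \<Omega>) \<ge> q * r" and f_in: "f y \<in> \<Omega>" if y: "y \<in> \<Omega>" for y
    proof -
      have w: "w \<in> \<Omega>" if "dist (f y) w < q * r" for w
      proof -
        define x where "x = z + (w - f y) /\<^sub>R q"
        have "norm ((w - f y) /\<^sub>R q) = norm (w - f y) / q"
          using q(1) by (simp add: divide_inverse_commute)
        also have "\<dots> < r" using that q(1) by (simp add: dist_norm norm_minus_commute divide_less_eq mult.commute)
        finally have "x \<in> ball z r" by (simp add: x_def dist_norm)
        then have "(1 - q) *\<^sub>R y + q *\<^sub>R x \<in> \<Omega>" using r y q by (intro convexD[OF cvx]) auto
        moreover have "(1 - q) *\<^sub>R y + q *\<^sub>R x = w" using q by (simp add: x_def f_def scaleR_add_right)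
        ultimately show ?thesis by simp
      qed
      show "infdist (f y) (- \<Omega>) \<ge> q * r"
        unfolding infdist_notempty[OF UN] using w by (intro cINF_greatest UN) force
      show "f y \<in> \<Omega>" using w[of "f y"] q r by simp
    qed
    have op: "open (f ` \<Omega>)"
      unfolding f_def using open_affinity[OF opn, of "1 - q" "q *\<^sub>R z"] q by (simp add: add.commute)
    have "measure lborel {x\<in>\<Omega>. infdist x (- \<Omega>) \<le> s} \<le> measure lborel (\<Omega> - f ` \<Omega>)"
    proof (rule measure_mono_fmeasurable)
      show "{x\<in>\<Omega>. infdist x (- \<Omega>) \<le> s} \<subseteq> \<Omega> - f ` \<Omega>" using f_dist q by fastforce
      have "{x\<in>\<Omega>. infdist x (- \<Omega>) \<le> s} = \<Omega> \<inter> {x. infdist x (- \<Omega>) \<le> s}" by auto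
      moreover have "closed {x. infdist x (- \<Omega>) \<le> s}"
        by (intro closed_Collect_le continuous_intros)
      ultimately show "{x\<in>\<Omega>. infdist x (- \<Omega>) \<le> s} \<in> sets lborel" using opn by auto
      show "\<Omega> - f ` \<Omega> \<in> fmeasurable lborel"
      proof (rule fmeasurableI)
        show "\<Omega> - f ` \<Omega> \<in> sets lborel" using opn op by auto
        show "emeasure lborel (\<Omega> - f ` \<Omega>) < \<infinity>"
          using emeasure_bounded_finite[of "\<Omega> - f ` \<Omega>"] bdd bounded_subset by blast
      qed
    qed
    also have "\<dots> = ?m - measure lborel (f ` \<Omega>)"
      using emb opn op f_in by (intro measure_Diff) auto
    also have "measure lborel (f ` \<Omega>) = (1 - q) ^ DIM('a) * ?m"
      unfolding f_def using q opn by (intro measure_lborel_affine_image) auto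
    also have "?m - (1 - q) ^ DIM('a) * ?m \<le> ?m - (1 - real DIM('a) * q) * ?m"
      using Bernoulli_inequality[of "- q" "DIM('a)"] q by (intro diff_left_mono mult_right_mono) auto
    also have "\<dots> = (2 * real DIM('a) * ?m / r) * s" by (simp add: q_def field_simps)
    finally show ?thesis .
  qed
  show ?thesis
    by (rule that[of "r / 4" "2 * real DIM('a) * ?m / r"]) (use r bound in auto)
qed

text \<open>Integration by parts against the cutoff \<open>\<eta>\<close>, a Lipschitz function of the distance to the complement.
Translation invariance makes the integral of the difference quotient of \<open>\<eta> f\<close> zero. The discrete product
rule splits this quotient into \<open>A\<close>, which converges to the integrand of interest, and \<open>R\<close>, which lives in
the boundary layer and is controlled there by the Lipschitz constant of \<open>\<eta>\<close> and the smallness of \<open>f\<close>.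
In this way \<open>\<eta>\<close> never has to be differentiated.\<close>

lemma cutoff_partial_integral_bound:
  fixes \<Omega> :: "'a::euclidean_space set" and f :: "'a \<Rightarrow> real"
  assumes opn: "open \<Omega>" and bdd: "bounded \<Omega>"
    and der: "\<And>x. x \<in> \<Omega> \<Longrightarrow> (f has_derivative f' x) (at x)"
    and cont: "continuous_on \<Omega> (\<lambda>x. f' x b)" and b: "norm b = 1"
    and eps: "\<epsilon> > 0"
    and small: "\<And>x. x \<in> \<Omega> \<Longrightarrow> infdist x (- \<Omega>) \<le> 3 * \<epsilon> \<Longrightarrow> \<bar>f x\<bar> \<le> e"
  defines "\<eta> \<equiv> \<lambda>x. max 0 (min 1 (infdist x (- \<Omega>) / \<epsilon> - 1))"
    and "K \<equiv> {x. \<epsilon> \<le> infdist x (- \<Omega>)}"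
  shows "integrable lborel (\<lambda>x. indicator K x * (\<eta> x * f' x b))"
    and "\<bar>\<integral>x. indicator K x * (\<eta> x * f' x b) \<partial>lborel\<bar>
           \<le> e / \<epsilon> * measure lborel {x\<in>\<Omega>. infdist x (- \<Omega>) \<le> 3 * \<epsilon>}"
proof -
  define d where "d x = infdist x (- \<Omega>)" for x
  define W where "W = {x\<in>\<Omega>. d x \<le> 3 * \<epsilon>}"
  have d_in: "x \<in> \<Omega>" if "d x > 0" for x using that by (cases "x \<in> \<Omega>") (auto simp: d_def)
  have lip: "\<bar>d x - d y\<bar> \<le> dist x y" for x y unfolding d_def by (rule infdist_triangle_abs)
  have contd: "continuous_on A d" for A unfolding d_def by (intro continuous_intros)
  have cmp: "compact {x. a \<le> d x}" if "a > 0" for a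
  proof -
    have "closed {x. a \<le> d x}" by (intro closed_Collect_le continuous_on_const contd)
    moreover have "{x. a \<le> d x} \<subseteq> \<Omega>" using that d_in by force
    ultimately show ?thesis using bdd bounded_subset by (auto simp: compact_eq_bounded_closed)
  qed
  have K: "K = {x. \<epsilon> \<le> d x}" by (simp add: K_def d_def)
  have K_in: "x \<in> \<Omega>" if "x \<in> K" for x using that eps d_in by (force simp: K)
  have eta: "\<eta> x = max 0 (min 1 (d x / \<epsilon> - 1))" for x by (simp add: \<eta>_def d_def)
  have conteta: "continuous_on A \<eta>" for A unfolding eta using eps by (intro continuous_intros contd) auto
  have eta0: "\<eta> x = 0" if "d x \<le> \<epsilon>" for x
    using that eps by (simp add: eta divide_le_eq)
  have eta1: "\<eta> x = 1" if "2 * \<epsilon> \<le> d x" for x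
    using that eps by (simp add: eta le_divide_eq)
  have etab: "0 \<le> \<eta> x" "\<eta> x \<le> 1" for x by (auto simp: eta)
  have indK: "indicator K x * (\<eta> x * y) = \<eta> x * y" for x y
    using eta0[of x] by (auto simp: K indicator_def)
  have etalip: "\<bar>\<eta> x - \<eta> y\<bar> \<le> dist x y / \<epsilon>" for x y
  proof -
    have "\<bar>\<eta> x - \<eta> y\<bar> \<le> \<bar>d x / \<epsilon> - d y / \<epsilon>\<bar>" by (auto simp: eta)
    also have "\<dots> = \<bar>d x - d y\<bar> / \<epsilon>" using eps by (simp add: diff_divide_distrib[symmetric])
    finally show ?thesis using lip[of x y] eps by (smt (verit) divide_right_mono)
  qed
  have contf: "continuous_on \<Omega> f"
    using der by (meson continuous_at_imp_continuous_on has_derivative_continuous)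
  have int_K: "integrable lborel (\<lambda>x. indicator K x * g x)" if "continuous_on K g" for g :: "'a \<Rightarrow> real"
    using borel_integrable_compact[of K g] cmp[OF eps] that by (simp add: K)
  \<comment> \<open>shifts of at most half the width \<open>\<epsilon>\<close> move no point of the support of the cutoff out of \<open>\<Omega>\<close>\<close>
  define t where "t n = \<epsilon> / (2 * real (Suc n))" for n
  have t: "t n > 0" "t n \<le> \<epsilon> / 2" for n
    using eps by (auto simp: t_def field_simps)
  have t0: "t \<longlonglongrightarrow> 0"
  proof -
    have "t = (\<lambda>n. \<epsilon> / 2 * inverse (real (Suc n)))" by (auto simp: t_def fun_eq_iff field_simps)
    then show ?thesis using tendsto_mult_left[OF LIMSEQ_inverse_real_of_nat, of "\<epsilon> / 2"] by simp
  qed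
  define \<Phi> where "\<Phi> x = indicator K x * (\<eta> x * f x)" for x
  define A where "A n x = indicator K x * (\<eta> x * ((f (t n *\<^sub>R b + x) - f x) / t n))" for n x
  define R where "R n x = (\<Phi> (t n *\<^sub>R b + x) - \<Phi> x) / t n - A n x" for n x
  have dist_t: "dist (t n *\<^sub>R b + x) x = t n" for n x using b t(1)[of n] by (simp add: dist_norm)
  have lipt: "\<bar>d (t n *\<^sub>R b + x) - d x\<bar> \<le> \<epsilon> / 2" for n x
    using lip[of "t n *\<^sub>R b + x" x] dist_t[of n x] t(2)[of n] by linarith
  have int_\<Phi>: "integrable lborel \<Phi>"
    unfolding \<Phi>_def using K_in
    by (intro int_K continuous_intros conteta continuous_on_subset[OF contf]) auto
  have int_A: "integrable lborel (A n)" for n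
    unfolding A_def
  proof (intro int_K continuous_intros conteta continuous_on_subset[OF contf])
    have "t n *\<^sub>R b + x \<in> \<Omega>" if "x \<in> K" for x
      using that lipt[of n x] eps d_in[of "t n *\<^sub>R b + x"] unfolding K mem_Collect_eq abs_le_iff by linarith
    then show "continuous_on K (\<lambda>x. f (t n *\<^sub>R b + x))"
      by (intro continuous_on_compose2[OF contf] continuous_intros) auto
  qed (use K_in t(1)[of n] in auto)
  have int_R: "integrable lborel (R n)" for n
    unfolding R_def using int_\<Phi> int_A integral_lborel_translate(1)[OF int_\<Phi>] by simp
  have W_fm: "W \<in> fmeasurable lborel"
  proof (rule fmeasurableI)
    have "W = \<Omega> \<inter> {x. d x \<le> 3 * \<epsilon>}" by (auto simp: W_def)
    moreover have "closed {x. d x \<le> 3 * \<epsilon>}" by (intro closed_Collect_le continuous_on_const contd)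
    ultimately show "W \<in> sets lborel" using opn by auto
    have "bounded W" using bdd by (rule bounded_subset) (auto simp: W_def)
    then show "emeasure lborel W < \<infinity>" by (rule emeasure_bounded_finite)
  qed
  have R_bound: "\<bar>R n x\<bar> \<le> e / \<epsilon> * indicator W x" for n x
  proof -
    let ?y = "t n *\<^sub>R b + x"
    have R_eq: "R n x = f ?y * ((\<eta> ?y - \<eta> x) / t n)"
      unfolding R_def \<Phi>_def A_def indK using t(1)[of n] by (simp add: field_simps)
    show ?thesis
    proof (cases "\<eta> ?y = \<eta> x")
      case True
      have "0 \<le> e" if "x \<in> W" using small[of x] that by (auto simp: W_def d_def)
      then show ?thesis using True eps by (auto simp: R_eq indicator_def)
    next
      case False
      have "\<epsilon> / 2 < d x" "\<epsilon> / 2 < d ?y" "d x \<le> 3 * \<epsilon>" "d ?y \<le> 3 * \<epsilon>"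
        using False eta0[of x] eta0[of ?y] eta1[of x] eta1[of ?y] lipt[of n x] eps by linarith+
      then have xW: "x \<in> W" and y: "?y \<in> \<Omega>" and yd: "d ?y \<le> 3 * \<epsilon>"
        using d_in[of x] d_in[of ?y] eps by (auto simp: W_def)
      have "\<bar>R n x\<bar> = \<bar>f ?y\<bar> * (\<bar>\<eta> ?y - \<eta> x\<bar> / t n)"
        using t(1)[of n] by (simp add: R_eq abs_mult)
      also have "\<dots> \<le> e * (1 / \<epsilon>)"
      proof (rule mult_mono)
        show "\<bar>f ?y\<bar> \<le> e" using small[OF y] yd by (simp add: d_def)
        then show "0 \<le> e" by linarith
        show "\<bar>\<eta> ?y - \<eta> x\<bar> / t n \<le> 1 / \<epsilon>"
          using etalip[of ?y x, unfolded dist_t] t(1)[of n] eps by (simp add: field_simps)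
      qed (use t(1)[of n] in auto)
      finally show ?thesis using xW by simp
    qed
  qed
  have A_bound: "\<bar>integral\<^sup>L lborel (A n)\<bar> \<le> e / \<epsilon> * measure lborel W" for n
  proof -
    have "integral\<^sup>L lborel (R n) =
        (integral\<^sup>L lborel (\<lambda>x. \<Phi> (t n *\<^sub>R b + x)) - integral\<^sup>L lborel \<Phi>) / t n - integral\<^sup>L lborel (A n)"
      unfolding R_def using int_\<Phi> int_A integral_lborel_translate(1)[OF int_\<Phi>] by simp
    then have "integral\<^sup>L lborel (R n) = - integral\<^sup>L lborel (A n)"
      by (simp add: integral_lborel_translate(2)[OF int_\<Phi>])
    then have "\<bar>integral\<^sup>L lborel (A n)\<bar> = \<bar>integral\<^sup>L lborel (R n)\<bar>" by simp
    also have "\<dots> \<le> (\<integral>x. \<bar>R n x\<bar> \<partial>lborel)" using integral_abs_bound by blast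
    also have "\<dots> \<le> (\<integral>x. e / \<epsilon> * indicator W x \<partial>lborel)"
      using int_R W_fm R_bound
      by (intro integral_mono) (auto simp: fmeasurable_def intro!: integrable_real_indicator)
    also have "\<dots> = e / \<epsilon> * measure lborel W" by simp
    finally show ?thesis .
  qed
  define A' where "A' x = indicator K x * (\<eta> x * f' x b)" for x
  have "integrable lborel A'"
    unfolding A'_def using K_in
    by (intro int_K continuous_intros conteta continuous_on_subset[OF cont]) auto
  then show "integrable lborel (\<lambda>x. indicator K x * (\<eta> x * f' x b))" by (simp add: A'_def[abs_def])
  have line: "((\<lambda>s. f (s *\<^sub>R b + x)) has_real_derivative f' (s *\<^sub>R b + x) b) (at s)"
    if "s *\<^sub>R b + x \<in> \<Omega>" for s x
  proof -
    have "((\<lambda>s. s *\<^sub>R b + x) has_derivative (\<lambda>h. h *\<^sub>R b)) (at s)"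
      by (auto intro!: derivative_eq_intros)
    from has_derivative_compose[OF this der[OF that]]
    have "((\<lambda>s. f (s *\<^sub>R b + x)) has_derivative (\<lambda>h. f' (s *\<^sub>R b + x) (h *\<^sub>R b))) (at s)" .
    moreover have "f' (s *\<^sub>R b + x) (h *\<^sub>R b) = f' (s *\<^sub>R b + x) b * h" for h
      using has_derivative_linear[OF der[OF that]] by (simp add: linear_cmul)
    ultimately show ?thesis by (simp add: has_field_derivative_def)
  qed
  have lim_A: "(\<lambda>n. integral\<^sup>L lborel (A n)) \<longlonglongrightarrow> integral\<^sup>L lborel A'"
  proof -
    have "continuous_on {x. \<epsilon> / 2 \<le> d x} (\<lambda>x. f' x b)"
      using d_in eps by (intro continuous_on_subset[OF cont]) force
    then have "compact ((\<lambda>x. f' x b) ` {x. \<epsilon> / 2 \<le> d x})"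
      using cmp[of "\<epsilon> / 2"] eps by (intro compact_continuous_image) auto
    then obtain B where B: "\<And>x. \<epsilon> / 2 \<le> d x \<Longrightarrow> \<bar>f' x b\<bar> \<le> B"
      using compact_imp_bounded bounded_real by (metis (no_types, lifting) imageI mem_Collect_eq)
    show ?thesis
    proof (rule integral_dominated_convergence[where w="\<lambda>x. indicator K x * B"])
      show "integrable lborel (\<lambda>x. indicator K x * B)" by (intro int_K continuous_intros)
      show "A' \<in> borel_measurable lborel" using \<open>integrable lborel A'\<close> by auto
      show "A n \<in> borel_measurable lborel" for n using int_A by auto
      show "AE x in lborel. (\<lambda>n. A n x) \<longlonglongrightarrow> A' x"
      proof (rule AE_I2)
        fix x
        show "(\<lambda>n. A n x) \<longlonglongrightarrow> A' x"
        proof (cases "x \<in> K")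
          case True
          then have "((\<lambda>s. f (s *\<^sub>R b + x)) has_real_derivative f' x b) (at 0)"
            using line[of 0 x] K_in by simp
          then have "((\<lambda>h. (f (h *\<^sub>R b + x) - f x) / h) \<longlongrightarrow> f' x b) (at 0)"
            by (simp add: DERIV_def)
          moreover have "filterlim t (at 0) sequentially"
            using t0 t(1) by (auto simp: filterlim_at intro!: always_eventually) (metis less_irrefl)
          ultimately have "(\<lambda>n. (f (t n *\<^sub>R b + x) - f x) / t n) \<longlonglongrightarrow> f' x b"
            by (rule filterlim_compose)
          then show ?thesis unfolding A_def A'_def by (intro tendsto_intros)
        qed (simp add: A_def A'_def)
      qed
      show "AE x in lborel. norm (A n x) \<le> indicator K x * B" for n
      proof (rule AE_I2)
        fix x
        show "norm (A n x) \<le> indicator K x * B"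
        proof (cases "x \<in> K")
          case True
          have seg: "\<epsilon> / 2 \<le> d (s *\<^sub>R b + x)" if "0 \<le> s" "s \<le> t n" for s
          proof -
            have "\<bar>d (s *\<^sub>R b + x) - d x\<bar> \<le> s" using lip[of "s *\<^sub>R b + x" x] b that by (simp add: dist_norm)
            then show ?thesis using True that t(2)[of n] by (auto simp: K)
          qed
          have "\<exists>z. 0 < z \<and> z < t n \<and> f (t n *\<^sub>R b + x) - f (0 *\<^sub>R b + x) = (t n - 0) * f' (z *\<^sub>R b + x) b"
          proof (intro MVT2 t(1) line d_in)
            show "0 < d (s *\<^sub>R b + x)" if "0 \<le> s" "s \<le> t n" for s
              using seg[OF that] eps by linarith
          qed
          then obtain z where z: "0 < z" "z < t n"
            "f (t n *\<^sub>R b + x) - f x = t n * f' (z *\<^sub>R b + x) b" by auto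
          then have "(f (t n *\<^sub>R b + x) - f x) / t n = f' (z *\<^sub>R b + x) b" using t(1)[of n] by simp
          then have "\<bar>(f (t n *\<^sub>R b + x) - f x) / t n\<bar> \<le> B" using B seg z by simp
          then have "\<eta> x * \<bar>(f (t n *\<^sub>R b + x) - f x) / t n\<bar> \<le> 1 * B"
            using etab by (intro mult_mono) auto
          then show ?thesis using True etab by (simp add: A_def abs_mult)
        qed (simp add: A_def)
      qed
    qed
  qed
  have "\<bar>integral\<^sup>L lborel A'\<bar> \<le> e / \<epsilon> * measure lborel W"
    using tendsto_rabs[OF lim_A] A_bound by (intro LIMSEQ_le_const2) auto
  then show "\<bar>\<integral>x. indicator K x * (\<eta> x * f' x b) \<partial>lborel\<bar>
      \<le> e / \<epsilon> * measure lborel {x\<in>\<Omega>. infdist x (- \<Omega>) \<le> 3 * \<epsilon>}"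
    by (simp add: A'_def[abs_def] W_def d_def)
qed

text \<open>A substitute for the divergence theorem on a convex domain. The gradient of the cutoff has size
\<open>1 / \<epsilon>\<close> on a layer of volume \<open>O(\<epsilon>)\<close>, where \<open>F\<close> is small; so the integral of the divergence against
the cutoff tends to zero, while a point of positive divergence would keep it away from zero. Nonnegativity
is what allows the derivatives of \<open>F\<close> to be arbitrarily large near the boundary.\<close>

lemma divergence_zero_of_nonneg:
  fixes \<Omega> :: "'a::euclidean_space set" and F :: "'a \<Rightarrow> 'a"
  assumes opn: "open \<Omega>" and cvx: "convex \<Omega>" and bdd: "bounded \<Omega>"
    and der: "\<And>x. x \<in> \<Omega> \<Longrightarrow> (F has_derivative F' x) (at x)"
    and cont: "\<And>b. b \<in> Basis \<Longrightarrow> continuous_on \<Omega> (\<lambda>x. F' x b \<bullet> b)"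
    and nonneg: "\<And>x. x \<in> \<Omega> \<Longrightarrow> 0 \<le> (\<Sum>b\<in>Basis. F' x b \<bullet> b)"
    and vanish: "\<And>e. e > 0 \<Longrightarrow> \<exists>\<delta>>0. \<forall>x\<in>\<Omega>. infdist x (- \<Omega>) < \<delta> \<longrightarrow> norm (F x) \<le> e"
    and x: "x \<in> \<Omega>"
  shows "(\<Sum>b\<in>Basis. F' x b \<bullet> b) = 0"
proof (rule ccontr)
  define D where "D x = (\<Sum>b\<in>Basis. F' x b \<bullet> b)" for x
  define d where "d x = infdist x (- \<Omega>)" for x
  assume "(\<Sum>b\<in>Basis. F' x b \<bullet> b) \<noteq> 0"
  then have Dx: "D x > 0" using nonneg[OF x] by (simp add: D_def)
  have UN: "- \<Omega> \<noteq> {}" by (rule Compl_bounded_nonempty[OF bdd])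
  have d_in: "y \<in> \<Omega>" if "d y > 0" for y using that by (cases "y \<in> \<Omega>") (auto simp: d_def)
  have dx: "d x > 0"
    using x opn in_closed_iff_infdist_zero[of "- \<Omega>" x] UN infdist_nonneg[of x "- \<Omega>"]
    by (auto simp: d_def closed_Compl less_le)
  have contD: "continuous_on \<Omega> D" unfolding D_def by (intro continuous_intros cont)
  have "isCont D x" using contD x opn by (simp add: continuous_on_eq_continuous_at)
  then obtain r0 where r0: "r0 > 0" "\<And>y. dist y x < r0 \<Longrightarrow> dist (D y) (D x) < D x / 2"
    using Dx unfolding continuous_at_eps_delta by (meson half_gt_zero)
  define r where "r = min (r0 / 2) (d x / 2)"
  have r: "r > 0" "r < r0" "r \<le> d x / 2" using r0 dx by (auto simp: r_def)
  have ball_d: "d y \<ge> d x / 2" if "y \<in> cball x r" for y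
    using that r infdist_triangle_abs[of x "- \<Omega>" y] by (auto simp: d_def)
  \<comment> \<open>the part of the integral contributed by a ball on which the divergence exceeds \<open>D x / 2\<close>\<close>
  define \<kappa> where "\<kappa> = D x / 2 * measure lborel (cball x r)"
  have \<kappa>: "\<kappa> > 0" using Dx r content_cball_pos[of r x] by (simp add: \<kappa>_def)
  obtain C s0 where C: "s0 > 0" "C \<ge> 0"
    "\<And>s. 0 < s \<Longrightarrow> s \<le> s0 \<Longrightarrow> measure lborel {x\<in>\<Omega>. infdist x (- \<Omega>) \<le> s} \<le> C * s"
    by (rule boundary_layer_measure[OF opn cvx bdd]) (use x in auto)
  \<comment> \<open>small enough that the boundary terms, at most \<open>3 C e\<close> per coordinate, stay below \<open>\<kappa>\<close>\<close>
  define e where "e = \<kappa> / (3 * real DIM('a) * C + 1)"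
  have e: "e > 0" using \<kappa> C by (simp add: e_def add_nonneg_pos)
  obtain \<delta> where \<delta>: "\<delta> > 0" "\<And>y. y \<in> \<Omega> \<Longrightarrow> infdist y (- \<Omega>) < \<delta> \<Longrightarrow> norm (F y) \<le> e"
    using vanish[OF e] by blast
  define \<epsilon> where "\<epsilon> = min (d x / 4) (min (s0 / 3) (\<delta> / 4))"
  have eps: "\<epsilon> > 0" "2 * \<epsilon> \<le> d x / 2" "3 * \<epsilon> \<le> s0" "3 * \<epsilon> < \<delta>"
    using dx C \<delta> by (auto simp: \<epsilon>_def)
  define \<eta> where "\<eta> = (\<lambda>x. max 0 (min 1 (infdist x (- \<Omega>) / \<epsilon> - 1)))"
  define K where "K = {x. \<epsilon> \<le> infdist x (- \<Omega>)}"
  have part: "integrable lborel (\<lambda>x. indicator K x * (\<eta> x * (F' x b \<bullet> b)))"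
    "\<bar>\<integral>x. indicator K x * (\<eta> x * (F' x b \<bullet> b)) \<partial>lborel\<bar>
       \<le> e / \<epsilon> * measure lborel {x\<in>\<Omega>. infdist x (- \<Omega>) \<le> 3 * \<epsilon>}" if b: "b \<in> Basis" for b
  proof -
    have "\<bar>F y \<bullet> b\<bar> \<le> e" if "y \<in> \<Omega>" "infdist y (- \<Omega>) \<le> 3 * \<epsilon>" for y
      using Basis_le_norm[OF b, of "F y"] \<delta>(2)[OF that(1)] that(2) eps by force
    note * = cutoff_partial_integral_bound[where f="\<lambda>x. F x \<bullet> b" and f'="\<lambda>x h. F' x h \<bullet> b" and b=b,
        OF opn bdd has_derivative_inner_left[OF der] cont[OF b] norm_Basis[OF b] eps(1) this]
    show "integrable lborel (\<lambda>x. indicator K x * (\<eta> x * (F' x b \<bullet> b)))"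
      unfolding K_def \<eta>_def by (intro *(1))
    show "\<bar>\<integral>x. indicator K x * (\<eta> x * (F' x b \<bullet> b)) \<partial>lborel\<bar>
       \<le> e / \<epsilon> * measure lborel {x\<in>\<Omega>. infdist x (- \<Omega>) \<le> 3 * \<epsilon>}"
      unfolding K_def \<eta>_def by (intro *(2))
  qed
  have ind_D: "indicator K y * (\<eta> y * D y) = (\<Sum>b\<in>Basis. indicator K y * (\<eta> y * (F' y b \<bullet> b)))" for y
    by (simp add: D_def sum_distrib_left)
  have "\<kappa> = (\<integral>y. indicator (cball x r) y * (D x / 2) \<partial>lborel)" by (simp add: \<kappa>_def)
  also have "\<dots> \<le> (\<integral>y. indicator K y * (\<eta> y * D y) \<partial>lborel)"
  proof (rule integral_mono)
    show "integrable lborel (\<lambda>y. indicator (cball x r) y * (D x / 2))"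
      by (intro integrable_mult_left integrable_real_indicator) (use emeasure_bounded_finite[OF bounded_cball] in auto)
    show "integrable lborel (\<lambda>y. indicator K y * (\<eta> y * D y))"
      unfolding ind_D using part by (intro Bochner_Integration.integrable_sum)
    show "indicator (cball x r) y * (D x / 2) \<le> indicator K y * (\<eta> y * D y)" for y
    proof (cases "y \<in> cball x r")
      case True
      then have dy: "2 * \<epsilon> \<le> d y" using ball_d eps by fastforce
      then have "\<eta> y = 1" "y \<in> K" using eps(1) by (auto simp: \<eta>_def K_def d_def le_divide_eq)
      moreover have "D x / 2 < D y" using True r r0(2)[of y] by (simp add: dist_commute dist_real_def) (auto simp: abs_if split: if_splits)
      ultimately show ?thesis using True by simp
    next
      case False
      have "0 \<le> D y" if "y \<in> K"
        using that eps(1) d_in[of y] nonneg[of y] by (auto simp: K_def d_def D_def)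
      then show ?thesis using False by (auto simp: indicator_def \<eta>_def)
    qed
  qed
  also have "\<dots> = (\<Sum>b\<in>Basis. \<integral>y. indicator K y * (\<eta> y * (F' y b \<bullet> b)) \<partial>lborel)"
    unfolding ind_D using part by (intro Bochner_Integration.integral_sum)
  also have "\<dots> \<le> (\<Sum>b\<in>(Basis::'a set). e / \<epsilon> * measure lborel {x\<in>\<Omega>. infdist x (- \<Omega>) \<le> 3 * \<epsilon>})"
    using part(2) by (intro sum_mono) (meson abs_le_D1)
  also have "\<dots> \<le> (\<Sum>b\<in>(Basis::'a set). e / \<epsilon> * (C * (3 * \<epsilon>)))"
    using C eps e by (intro sum_mono mult_left_mono) auto
  also have "\<dots> = 3 * real DIM('a) * C * e" using eps(1) by simp
  also have "\<dots> < (3 * real DIM('a) * C + 1) * e" using e by (simp add: algebra_simps)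
  also have "\<dots> = \<kappa>"
  proof -
    have "3 * real DIM('a) * C + 1 > 0" using C(2) by (simp add: add_nonneg_pos)
    then show ?thesis by (simp add: e_def)
  qed
  finally show False by simp
qed

section \<open>Supporting normals of a convex set with regular boundary\<close>

lemma ball_add_mem: "ball z r \<subseteq> S \<Longrightarrow> norm v < r \<Longrightarrow> z + v \<in> S"
  for z v :: "'a::real_normed_vector"
  by (rule subsetD[of "ball z r"]) (simp_all add: dist_norm)

definition supporting_normal :: "'a::euclidean_space set \<Rightarrow> 'a \<Rightarrow> 'a \<Rightarrow> bool" where
  "supporting_normal G P n \<longleftrightarrow> norm n = 1 \<and> (\<forall>y\<in>G. 0 \<le> n \<bullet> (y - P))"

text \<open>For a compact set of directions \<open>v\<close> with \<open>a \<bullet> v > 0\<close>, the points \<open>P + t v\<close> with small \<open>t > 0\<close> miss the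
frontier, because \<open>\<phi>\<close> is positive there to first order. Moving the direction from \<open>z - P\<close>, which points into \<open>G\<close>, to \<open>w\<close>
within this half space traces a connected set that misses the frontier, so it stays inside \<open>G\<close>.\<close>

lemma gradient_side_in_convex:
  fixes G :: "'a::euclidean_space set"
  assumes G: "open G" "convex G" and P: "P \<in> frontier G"
    and U: "open U" "P \<in> U" "frontier G \<inter> U = {x \<in> U. \<phi> x = 0}"
    and der: "(\<phi> has_derivative (\<lambda>h. a \<bullet> h)) (at P)"
    and z: "z \<in> G" "a \<bullet> (z - P) > 0" and w: "a \<bullet> w > 0"
  shows "\<exists>e>0. \<forall>t. 0 < t \<and> t < e \<longrightarrow> P + t *\<^sub>R w \<in> G"
proof -
  define v where "v s = (1 - s) *\<^sub>R (z - P) + s *\<^sub>R w" for s :: real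
  define c where "c = min (a \<bullet> (z - P)) (a \<bullet> w)"
  define R where "R = max (norm (z - P)) (norm w) + 1"
  have c: "c > 0" using z w by (simp add: c_def)
  have R: "R > 0" by (simp add: R_def add_nonneg_pos le_max_iff_disj)
  have "c / (2 * R) > 0" using c R by simp
  then obtain d where d: "d > 0"
    "\<And>y. norm (y - P) < d \<Longrightarrow> \<bar>\<phi> y - \<phi> P - a \<bullet> (y - P)\<bar> \<le> c / (2 * R) * norm (y - P)"
    using der unfolding has_derivative_at_alt real_norm_def by meson
  obtain d1 where d1: "d1 > 0" "ball P d1 \<subseteq> U" using U by (auto simp: open_contains_ball)
  have "\<phi> P = 0" using P U by blast
  define e where "e = min 1 (min d d1 / R)"
  have e: "e > 0" using d d1 R by (simp add: e_def)
  have vR: "norm (v s) \<le> R" and av: "a \<bullet> v s \<ge> c" if s: "0 \<le> s" "s \<le> 1" for s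
  proof -
    have "norm (v s) \<le> (1 - s) * norm (z - P) + s * norm w"
      unfolding v_def using s by (intro order_trans[OF norm_triangle_ineq]) simp
    also have "\<dots> \<le> (1 - s) * R + s * R"
      using s by (intro add_mono mult_left_mono) (auto simp: R_def)
    finally show "norm (v s) \<le> R" by (simp add: algebra_simps)
    have "c = (1 - s) * c + s * c" by (simp add: algebra_simps)
    also have "\<dots> \<le> (1 - s) * (a \<bullet> (z - P)) + s * (a \<bullet> w)"
      using s by (intro add_mono mult_left_mono) (auto simp: c_def)
    finally show "a \<bullet> v s \<ge> c" by (simp add: v_def inner_add_right)
  qed
  have "P + t *\<^sub>R w \<in> G" if t: "0 < t" "t < e" for t
  proof (rule ccontr)
    assume notin: "P + t *\<^sub>R w \<notin> G"
    have t1: "t \<le> 1" "t * R < d" "t * R < d1" using t R by (auto simp: e_def field_simps)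
    define T where "T = (\<lambda>s. P + t *\<^sub>R v s) ` {0..1}"
    have "connected T" unfolding T_def v_def
      by (intro connected_continuous_image continuous_intros) auto
    moreover have "T \<inter> G \<noteq> {}"
    proof -
      have "P - t *\<^sub>R (P - z) \<in> interior G"
        using P z G t t1 by (intro mem_interior_closure_convex_shrink)
          (auto simp: frontier_def interior_open)
      then have "P + t *\<^sub>R v 0 \<in> G" using G by (simp add: v_def interior_open algebra_simps)
      moreover have "P + t *\<^sub>R v 0 \<in> T" unfolding T_def by (rule imageI) simp
      ultimately show ?thesis by blast
    qed
    moreover have "T - G \<noteq> {}"
    proof -
      have "P + t *\<^sub>R v 1 \<in> T" unfolding T_def by (rule imageI) simp
      then show ?thesis using notin by (auto simp: v_def)
    qed
    ultimately have "T \<inter> frontier G \<noteq> {}" by (rule connected_Int_frontier)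
    then obtain s where s: "0 \<le> s" "s \<le> 1" "P + t *\<^sub>R v s \<in> frontier G" by (auto simp: T_def)
    define y where "y = P + t *\<^sub>R v s"
    have yP: "y - P = t *\<^sub>R v s" by (simp add: y_def)
    have ny: "norm (y - P) \<le> t * R" using vR[OF s(1,2)] t by (simp add: yP)
    then have "y \<in> U" using d1 t1 by (auto simp: dist_norm norm_minus_commute subset_iff)
    then have "\<phi> y = 0" using s(3) U(3) unfolding y_def by blast
    moreover have "\<bar>\<phi> y - \<phi> P - a \<bullet> (y - P)\<bar> \<le> c / (2 * R) * norm (y - P)"
      using ny t1 by (intro d) auto
    moreover have "c / (2 * R) * norm (y - P) \<le> c / (2 * R) * (t * R)"
      using ny c R by (intro mult_left_mono) auto
    moreover have "c / (2 * R) * (t * R) = t * c / 2" using R by simp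
    moreover have "a \<bullet> (y - P) \<ge> t * c" using av[OF s(1,2)] t by (simp add: yP)
    moreover have "t * c > 0" using t c by simp
    ultimately show False using \<open>\<phi> P = 0\<close> by linarith
  qed
  with e show ?thesis by blast
qed

text \<open>All directions of the open half space \<open>a \<bullet> w > 0\<close> point into \<open>G\<close>, hence \<open>n\<close> is nonnegative on them
and must be the direction of \<open>a\<close>. In particular the supporting normal is unique. The second claim says that
the normal itself, and every direction making an acute angle with it, points into \<open>G\<close>.\<close>

lemma supporting_normal_eq_gradient_pos:
  fixes G :: "'a::euclidean_space set"
  assumes G: "open G" "convex G" and P: "P \<in> frontier G"
    and U: "open U" "P \<in> U" "frontier G \<inter> U = {x \<in> U. \<phi> x = 0}"
    and der: "(\<phi> has_derivative (\<lambda>h. a \<bullet> h)) (at P)"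
    and z: "z \<in> G" "a \<bullet> (z - P) > 0" and n: "supporting_normal G P n"
  shows "n = (1 / norm a) *\<^sub>R a"
    and "n \<bullet> w > 0 \<Longrightarrow> \<exists>e>0. \<forall>t. 0 < t \<and> t < e \<longrightarrow> P + t *\<^sub>R w \<in> G"
proof -
  have a: "norm a > 0" using z by auto
  have side: "\<exists>e>0. \<forall>t. 0 < t \<and> t < e \<longrightarrow> P + t *\<^sub>R w \<in> G" if "a \<bullet> w > 0" for w
    by (rule gradient_side_in_convex[OF G P U der z that])
  have pos: "n \<bullet> w \<ge> 0" if aw: "a \<bullet> w > 0" for w
  proof -
    obtain e where e: "e > 0" "\<forall>t. 0 < t \<and> t < e \<longrightarrow> P + t *\<^sub>R w \<in> G"
      using side[OF aw] by blast
    then have "P + (e / 2) *\<^sub>R w \<in> G" by simp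
    then have "0 \<le> n \<bullet> ((P + (e / 2) *\<^sub>R w) - P)" using n unfolding supporting_normal_def by blast
    then show ?thesis using e by (simp add: zero_le_mult_iff)
  qed
  have nn: "norm n = 1" "n \<bullet> n = 1" using n by (auto simp: supporting_normal_def dot_square_norm)
  define \<alpha> where "\<alpha> = n \<bullet> a"
  have \<alpha>: "\<alpha> \<ge> 0" unfolding \<alpha>_def using a by (intro pos) (simp add: dot_square_norm)
  have "\<alpha> \<ge> norm a"
  proof (rule ccontr)
    assume "\<not> \<alpha> \<ge> norm a"
    then have lt: "\<alpha>\<^sup>2 < (norm a)\<^sup>2" using \<alpha> by (intro power_strict_mono) auto
    define \<beta> where "\<beta> = 1 - \<alpha>\<^sup>2 / (norm a)\<^sup>2"
    have \<beta>: "\<beta> > 0" using lt a by (simp add: \<beta>_def)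
    define \<delta> where "\<delta> = \<beta> / (2 * (\<alpha> + 1))"
    have \<delta>: "\<delta> > 0" using \<alpha> \<beta> by (simp add: \<delta>_def)
    have d\<alpha>: "\<delta> * \<alpha> < \<beta>"
    proof -
      have "\<delta> * \<alpha> \<le> \<delta> * (\<alpha> + 1)" using \<delta> by (intro mult_left_mono) auto
      also have "\<dots> = \<beta> / 2"
      proof -
        have "\<alpha> + 1 \<noteq> 0" using \<alpha> by linarith
        then show ?thesis unfolding \<delta>_def by (simp only: times_divide_eq_left) (simp add: field_simps)
      qed
      finally show ?thesis using \<beta> by linarith
    qed
    \<comment> \<open>without the perturbation by \<open>\<delta> a\<close> this vector lies on the hyperplane orthogonal to \<open>a\<close>\<close>
    let ?w = "(\<alpha> / (norm a)\<^sup>2 + \<delta>) *\<^sub>R a - n"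
    have "a \<bullet> ?w = \<delta> * (norm a)\<^sup>2"
      using a by (simp add: inner_diff_right dot_square_norm \<alpha>_def inner_commute[of a n] algebra_simps)
    then have "n \<bullet> ?w \<ge> 0" using \<delta> a by (intro pos) simp
    moreover have "n \<bullet> ?w = \<alpha>\<^sup>2 / (norm a)\<^sup>2 + \<delta> * \<alpha> - 1"
      using nn by (simp add: inner_diff_right \<alpha>_def[symmetric] algebra_simps power2_eq_square)
    ultimately show False using d\<alpha> by (simp add: \<beta>_def)
  qed
  then have "n \<bullet> a = norm n * norm a"
    using norm_cauchy_schwarz[of n a] nn by (simp add: \<alpha>_def)
  then have "norm n *\<^sub>R a = norm a *\<^sub>R n" by (simp add: norm_cauchy_schwarz_eq)
  then have na: "a = norm a *\<^sub>R n" by (simp add: nn)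
  show "n = (1 / norm a) *\<^sub>R a" using a by (subst (2) na) simp
  show "\<exists>e>0. \<forall>t. 0 < t \<and> t < e \<longrightarrow> P + t *\<^sub>R w \<in> G" if "n \<bullet> w > 0"
  proof -
    have "a \<bullet> w = norm a * (n \<bullet> w)" by (subst na) simp
    then show ?thesis using that a by (intro side) simp
  qed
qed

lemma supporting_normal_eq_gradient:
  fixes G :: "'a::euclidean_space set"
  assumes G: "open G" "convex G" "G \<noteq> {}" and P: "P \<in> frontier G"
    and U: "open U" "P \<in> U" "frontier G \<inter> U = {x \<in> U. \<phi> x = 0}"
    and der: "(\<phi> has_derivative (\<lambda>h. a \<bullet> h)) (at P)" and a: "a \<noteq> 0"
    and n: "supporting_normal G P n"
  shows "n = (1 / norm a) *\<^sub>R a \<or> n = (- 1 / norm a) *\<^sub>R a"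
    and "n \<bullet> w > 0 \<Longrightarrow> \<exists>e>0. \<forall>t. 0 < t \<and> t < e \<longrightarrow> P + t *\<^sub>R w \<in> G"
proof -
  obtain z0 where z0: "z0 \<in> G" using G by auto
  have "\<exists>z\<in>G. a \<bullet> (z - P) \<noteq> 0"
  proof (cases "a \<bullet> (z0 - P) = 0")
    case True
    obtain r where r: "r > 0" "ball z0 r \<subseteq> G" using G z0 by (auto simp: open_contains_ball)
    let ?z = "z0 + (r / (2 * norm a)) *\<^sub>R a"
    have "?z \<in> G" using r a by (intro ball_add_mem) auto
    moreover have "a \<bullet> (?z - P) \<noteq> 0"
    proof -
      have "a \<bullet> (?z - P) = a \<bullet> (z0 - P) + (r / (2 * norm a)) * (a \<bullet> a)"
        by (simp add: inner_diff_right inner_add_right)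
      then show ?thesis using True r a by simp
    qed
    ultimately show ?thesis by blast
  qed (use z0 in blast)
  then obtain z where z: "z \<in> G" "a \<bullet> (z - P) \<noteq> 0" by blast
  have neg: "frontier G \<inter> U = {x \<in> U. - \<phi> x = 0}" using U by simp
  have nder: "((\<lambda>x. - \<phi> x) has_derivative (\<lambda>h. (- a) \<bullet> h)) (at P)"
    using has_derivative_minus[OF der] by simp
  show "n = (1 / norm a) *\<^sub>R a \<or> n = (- 1 / norm a) *\<^sub>R a"
  proof (cases "a \<bullet> (z - P) > 0")
    case True
    show ?thesis using supporting_normal_eq_gradient_pos(1)[OF G(1,2) P U der z(1) True n] by simp
  next
    case False
    then have "(- a) \<bullet> (z - P) > 0" using z by simp
    from supporting_normal_eq_gradient_pos(1)[OF G(1,2) P U(1,2) neg nder z(1) this n] show ?thesis by simp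
  qed
  show "\<exists>e>0. \<forall>t. 0 < t \<and> t < e \<longrightarrow> P + t *\<^sub>R w \<in> G" if "n \<bullet> w > 0"
  proof (cases "a \<bullet> (z - P) > 0")
    case True
    show ?thesis by (rule supporting_normal_eq_gradient_pos(2)[OF G(1,2) P U der z(1) True n that])
  next
    case False
    then have "(- a) \<bullet> (z - P) > 0" using z by simp
    from supporting_normal_eq_gradient_pos(2)[OF G(1,2) P U(1,2) neg nder z(1) this n that] show ?thesis .
  qed
qed

text \<open>With \<open>(y\<^sub>1, a)\<close> and \<open>(y\<^sub>2, b)\<close> unit vectors, \<open>y\<^sub>1 / a\<close> and \<open>y\<^sub>2 / b\<close> are the gradients whose images
under \<open>p \<mapsto> p / sqrt (1 + \<bar>p\<bar>\<^sup>2)\<close> are \<open>y\<^sub>1\<close> and \<open>y\<^sub>2\<close>; the identity makes the strict monotonicity of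
this map explicit.\<close>

lemma graph_operator_monotone:
  fixes y1 y2 :: "'a::real_inner"
  assumes a: "a > 0" "y1 \<bullet> y1 + a\<^sup>2 = 1" and b: "b > 0" "y2 \<bullet> y2 + b\<^sup>2 = 1"
  shows "((1 / a) *\<^sub>R y1 - (1 / b) *\<^sub>R y2) \<bullet> (y1 - y2)
    = (1 / a + 1 / b) / 2 * ((norm (y1 - y2))\<^sup>2 + (a - b)\<^sup>2)"
proof -
  define c where "c = y1 \<bullet> y2"
  have y: "y1 \<bullet> y1 = 1 - a\<^sup>2" "y2 \<bullet> y2 = 1 - b\<^sup>2" using a b by auto
  have "((1 / a) *\<^sub>R y1 - (1 / b) *\<^sub>R y2) \<bullet> (y1 - y2)
      = (1 - a\<^sup>2) / a - c / a - c / b + (1 - b\<^sup>2) / b"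
    by (simp add: inner_diff_left inner_diff_right y c_def inner_commute[of y2 y1] diff_divide_distrib)
  also have "\<dots> = (1 / a + 1 / b) * (1 - a * b - c)"
    using a(1) b(1) by (simp add: field_simps power2_eq_square)
  also have "1 - a * b - c = ((norm (y1 - y2))\<^sup>2 + (a - b)\<^sup>2) / 2"
    by (simp add: power2_norm_eq_inner inner_diff_left inner_diff_right y inner_commute[of y2 y1] c_def)
      (simp add: power2_eq_square algebra_simps)
  finally show ?thesis by simp
qed

locale analytic_convex_body =
  fixes M G :: "('b::euclidean_space \<times> real) set"
  assumes hyp: "real_analytic_hypersurface M"
    and opn: "open G" and bdd: "bounded G" and cvx: "convex G" and ne: "G \<noteq> {}"
    and front: "frontier G = M"
begin

definition gauss_map :: "'b \<times> real \<Rightarrow> 'b \<times> real" where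
  "gauss_map P = (THE n. supporting_normal G P n)"

lemma M_eq: "M = closure G - G"
  using front opn by (simp add: frontier_def interior_open)

lemma compact_M: "compact M"
  using front bdd compact_frontier_bounded by blast

definition defining_data where
  "defining_data P \<delta> \<phi> A B \<longleftrightarrow> \<delta> > 0 \<and> gradient_hessian_on \<phi> A B (ball P \<delta>) \<and>
     M \<inter> ball P \<delta> = {x \<in> ball P \<delta>. \<phi> x = 0} \<and> (\<forall>x\<in>ball P \<delta>. A x \<noteq> 0)"

lemma defining_data_exists:
  assumes P: "P \<in> M"
  shows "\<exists>\<delta> \<phi> A B. defining_data P \<delta> \<phi> A B"
proof -
  obtain U \<phi> where U: "open U" "P \<in> U" and an: "real_analytic_on \<phi> U"
    and MU: "M \<inter> U = {x\<in>U. \<phi> x = 0}"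
    and reg: "\<forall>x\<in>M \<inter> U. frechet_derivative \<phi> (at x) \<noteq> (\<lambda>_. 0)"
    using bspec[OF hyp[unfolded real_analytic_hypersurface_def] P]
    by (elim exE conjE) (rule that)
  obtain \<delta> A B where \<delta>: "\<delta> > 0" and gh: "gradient_hessian_on \<phi> A B (ball P \<delta>)"
    using real_analytic_on_imp_C2[OF an U(2)] by blast
  have PP: "P \<in> ball P \<delta>" using \<delta> by simp
  obtain \<delta>1 where \<delta>1: "\<delta>1 > 0" "ball P \<delta>1 \<subseteq> U" using U open_contains_ball by blast
  have dA: "(\<phi> has_derivative (\<lambda>h. A P \<bullet> h)) (at P)" and dB: "(A has_derivative B P) (at P)"
    using gh PP unfolding gradient_hessian_on_def by auto
  have "frechet_derivative \<phi> (at P) = (\<lambda>h. A P \<bullet> h)"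
    using frechet_derivative_at[OF dA] by simp
  then have "A P \<noteq> 0" using reg P U by force
  moreover have "isCont A P" using has_derivative_continuous[OF dB] .
  ultimately obtain \<delta>2 where \<delta>2: "\<delta>2 > 0" "\<And>x. dist P x < \<delta>2 \<Longrightarrow> A x \<noteq> 0"
    using continuous_at_avoid[of P A 0] by blast
  define d where "d = min \<delta> (min \<delta>1 \<delta>2)"
  have sub: "ball P d \<subseteq> ball P \<delta>" "ball P d \<subseteq> U" using \<delta>1(2) by (auto simp: d_def)
  have "gradient_hessian_on \<phi> A B (ball P d)"
    using gh sub(1) continuous_on_subset[OF _ sub(1)] unfolding gradient_hessian_on_def by blast
  moreover have "M \<inter> ball P d = {x \<in> ball P d. \<phi> x = 0}" using MU sub(2) by blast
  moreover have "\<forall>x\<in>ball P d. A x \<noteq> 0" using \<delta>2(2) by (auto simp: d_def)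
  moreover have "d > 0" using \<delta> \<delta>1 \<delta>2 by (simp add: d_def)
  ultimately show ?thesis unfolding defining_data_def by blast
qed

lemma defining_dataD:
  assumes "defining_data P \<delta> \<phi> A B"
  shows "\<delta> > 0" and "P \<in> ball P \<delta>" and "frontier G \<inter> ball P \<delta> = {x \<in> ball P \<delta>. \<phi> x = 0}"
    and "\<And>x. x \<in> ball P \<delta> \<Longrightarrow> (\<phi> has_derivative (\<lambda>h. A x \<bullet> h)) (at x)"
    and "\<And>x. x \<in> ball P \<delta> \<Longrightarrow> (A has_derivative B x) (at x)"
    and "\<And>x u v. x \<in> ball P \<delta> \<Longrightarrow> B x u \<bullet> v = u \<bullet> B x v"
    and "\<And>k. continuous_on (ball P \<delta>) (\<lambda>x. B x k)"
    and "\<And>x. x \<in> ball P \<delta> \<Longrightarrow> A x \<noteq> 0"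
  using assms front unfolding defining_data_def gradient_hessian_on_def by auto

lemma supporting_normal_exists:
  assumes P: "P \<in> M"
  shows "\<exists>n. supporting_normal G P n"
proof -
  obtain a b where ab: "a \<noteq> 0" "\<forall>x\<in>{P}. a \<bullet> x \<le> b" "\<forall>x\<in>G. a \<bullet> x \<ge> b"
    using separating_hyperplane_sets[of "{P}" G] cvx ne P by (auto simp: M_eq)
  have "supporting_normal G P ((1 / norm a) *\<^sub>R a)"
    using ab by (auto simp: supporting_normal_def inner_diff_right intro!: divide_right_mono)
  then show ?thesis by blast
qed

text \<open>Both normals are parallel to the gradient of a defining function. If they were opposite, the open set \<open>G\<close>
would lie in a hyperplane.\<close>

lemma supporting_normal_unique:
  assumes P: "P \<in> M" and n: "supporting_normal G P n" and m: "supporting_normal G P m"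
  shows "m = n"
proof -
  obtain \<delta> \<phi> A B where data: "defining_data P \<delta> \<phi> A B" using defining_data_exists[OF P] by blast
  note * = defining_dataD[OF data]
  have Pf: "P \<in> frontier G" using P front by simp
  note grad = supporting_normal_eq_gradient(1)[OF opn cvx ne Pf open_ball *(2) *(3) *(4)[OF *(2)] *(8)[OF *(2)]]
  have "m = n \<or> m = - n" using grad[OF n] grad[OF m] by auto
  moreover have "m \<noteq> - n"
  proof
    assume mn: "m = - n"
    have eq0: "n \<bullet> (y - P) = 0" if "y \<in> G" for y
      using n m that unfolding supporting_normal_def mn by force
    obtain z where z: "z \<in> G" using ne by blast
    then obtain r where r: "r > 0" "ball z r \<subseteq> G" using opn open_contains_ball by blast
    have nn: "norm n = 1" using n by (simp add: supporting_normal_def)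
    have "z + (r / 2) *\<^sub>R n \<in> G" using r nn by (intro ball_add_mem[OF r(2)]) simp
    from eq0[OF this] eq0[OF z] have "(r / 2) * (n \<bullet> n) = 0"
      by (simp add: inner_diff_right inner_add_right)
    then show False using r nn by (simp add: dot_square_norm)
  qed
  ultimately show ?thesis by simp
qed

lemma supporting_normal_gauss_map: "P \<in> M \<Longrightarrow> supporting_normal G P (gauss_map P)"
  unfolding gauss_map_def
proof (rule theI')
  assume P: "P \<in> M"
  obtain n where n: "supporting_normal G P n" using supporting_normal_exists[OF P] by blast
  show "\<exists>!n. supporting_normal G P n"
    by (rule ex1I[of "supporting_normal G P" n, OF n]) (rule supporting_normal_unique[OF P n])
qed

lemma gauss_map_unique: "P \<in> M \<Longrightarrow> supporting_normal G P n \<Longrightarrow> n = gauss_map P"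
  by (rule supporting_normal_unique[OF _ supporting_normal_gauss_map])

lemma norm_gauss_map: "P \<in> M \<Longrightarrow> norm (gauss_map P) = 1"
  using supporting_normal_gauss_map[of P] by (simp add: supporting_normal_def)

lemma gauss_map_closure_nonneg:
  assumes P: "P \<in> M" and y: "y \<in> closure G"
  shows "0 \<le> gauss_map P \<bullet> (y - P)"
proof -
  have "closed {y. 0 \<le> gauss_map P \<bullet> (y - P)}"
    by (rule closed_Collect_le) (intro continuous_intros)+
  moreover have "G \<subseteq> {y. 0 \<le> gauss_map P \<bullet> (y - P)}"
    using supporting_normal_gauss_map[OF P] by (auto simp: supporting_normal_def)
  ultimately show ?thesis using closure_minimal y by blast
qed

lemma gauss_map_pos:
  assumes P: "P \<in> M" and y: "y \<in> G"
  shows "0 < gauss_map P \<bullet> (y - P)"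
proof -
  obtain r where r: "r > 0" "ball y r \<subseteq> G" using opn y by (auto simp: open_contains_ball)
  have "y + (- (r / 2) *\<^sub>R gauss_map P) \<in> G" using r norm_gauss_map[OF P] by (intro ball_add_mem[OF r(2)]) simp
  then have "0 \<le> gauss_map P \<bullet> (y - (r / 2) *\<^sub>R gauss_map P - P)"
    using supporting_normal_gauss_map[OF P] by (auto simp: supporting_normal_def)
  also have "\<dots> = gauss_map P \<bullet> (y - P) - r / 2"
    using norm_gauss_map[OF P] by (simp add: inner_diff_right dot_square_norm)
  finally show ?thesis using r by simp
qed

lemma gauss_map_points_inside:
  assumes P: "P \<in> M"
  shows "\<exists>e>0. \<forall>t. 0 < t \<and> t < e \<longrightarrow> P + t *\<^sub>R gauss_map P \<in> G"
proof -
  obtain \<delta> \<phi> A B where data: "defining_data P \<delta> \<phi> A B" using defining_data_exists[OF P] by blast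
  note * = defining_dataD[OF data]
  have Pf: "P \<in> frontier G" using P front by simp
  show ?thesis
    using norm_gauss_map[OF P]
    by (intro supporting_normal_eq_gradient(2)[OF opn cvx ne Pf open_ball *(2) *(3) *(4)[OF *(2)] *(8)[OF *(2)]
          supporting_normal_gauss_map[OF P]]) (simp add: dot_square_norm)
qed

text \<open>A limit of supporting normals supports at the limit point, so the graph of the map is closed; uniqueness of
the normal and compactness of the sphere do the rest.\<close>

lemma continuous_on_gauss_map: "continuous_on M gauss_map"
proof (rule continuous_from_closed_graph)
  show "compact (sphere (0 :: 'b \<times> real) 1)" by simp
  show "gauss_map \<in> M \<rightarrow> sphere 0 1" using norm_gauss_map by auto
  have "(\<lambda>P. (P, gauss_map P)) ` M = {z. fst z \<in> M \<and> supporting_normal G (fst z) (snd z)}"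
  proof (intro set_eqI iffI)
    fix z assume "z \<in> {z. fst z \<in> M \<and> supporting_normal G (fst z) (snd z)}"
    then have "fst z \<in> M" "snd z = gauss_map (fst z)" by (auto intro: gauss_map_unique)
    then show "z \<in> (\<lambda>P. (P, gauss_map P)) ` M" by (intro image_eqI[of _ _ "fst z"]) (auto simp: prod_eq_iff)
  next
    fix z assume "z \<in> (\<lambda>P. (P, gauss_map P)) ` M"
    then obtain P where "P \<in> M" "z = (P, gauss_map P)" by blast
    then show "z \<in> {z. fst z \<in> M \<and> supporting_normal G (fst z) (snd z)}"
      using supporting_normal_gauss_map by simp
  qed
  also have "\<dots> = (fst -` M) \<inter> {z. norm (snd z) = 1} \<inter> (\<Inter>y\<in>G. {z. 0 \<le> snd z \<bullet> (y - fst z)})"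
    unfolding supporting_normal_def by blast
  finally show "closed ((\<lambda>P. (P, gauss_map P)) ` M)"
    using compact_imp_closed[OF compact_M]
    by (simp only:) (intro closed_Int closed_INT ballI closed_Collect_le closed_Collect_eq continuous_intros)
qed

text \<open>A local extension of the Gauss map to a differentiable field of unit vectors in the ambient space. Its
derivative restricted to the tangent space is symmetric; this yields the self-adjoint shape operator.\<close>

definition normal_extension where
  "normal_extension P \<delta> V DV \<longleftrightarrow> \<delta> > 0 \<and>
     (\<forall>x\<in>ball P \<delta>. (V has_derivative DV x) (at x) \<and> norm (V x) = 1) \<and>
     (\<forall>k. continuous_on (ball P \<delta>) (\<lambda>x. DV x k)) \<and>
     (\<forall>x\<in>M \<inter> ball P \<delta>. gauss_map x = V x \<and>
        (\<forall>v w. v \<bullet> gauss_map x = 0 \<longrightarrow> w \<bullet> gauss_map x = 0 \<longrightarrow> DV x v \<bullet> w = v \<bullet> DV x w))"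

lemma normal_extensionD:
  assumes "normal_extension P \<delta> V DV"
  shows "\<delta> > 0" and "P \<in> ball P \<delta>"
    and "\<And>x. x \<in> ball P \<delta> \<Longrightarrow> (V has_derivative DV x) (at x)"
    and "\<And>k. continuous_on (ball P \<delta>) (\<lambda>x. DV x k)"
    and "\<And>x. x \<in> ball P \<delta> \<Longrightarrow> norm (V x) = 1"
    and "\<And>x. x \<in> M \<Longrightarrow> x \<in> ball P \<delta> \<Longrightarrow> gauss_map x = V x"
    and "\<And>x v w. x \<in> M \<Longrightarrow> x \<in> ball P \<delta> \<Longrightarrow> v \<bullet> gauss_map x = 0 \<Longrightarrow> w \<bullet> gauss_map x = 0 \<Longrightarrow> DV x v \<bullet> w = v \<bullet> DV x w"
  using assms unfolding normal_extension_def by auto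

text \<open>The extension is the normalized gradient of a defining function, with the sign fixed at \<open>P\<close>. The sign stays
correct on the hypersurface near \<open>P\<close> because the Gauss map is continuous. Symmetry on the tangent space
comes from the Hessian: the remaining terms of the derivative are multiples of the gradient.\<close>

lemma normal_extension_exists:
  assumes P: "P \<in> M"
  shows "\<exists>\<delta> V DV. normal_extension P \<delta> V DV"
proof -
  obtain \<delta> \<phi> A B where data: "defining_data P \<delta> \<phi> A B" using defining_data_exists[OF P] by blast
  note \<delta> = defining_dataD(1)[OF data] and Mb = defining_dataD(3)[OF data]
    and dA = defining_dataD(4)[OF data] and dB = defining_dataD(5)[OF data]
    and sym = defining_dataD(6)[OF data] and cB = defining_dataD(7)[OF data]
    and A0 = defining_dataD(8)[OF data]
  have sgn: "gauss_map x = sgn (A x) \<or> gauss_map x = - sgn (A x)" if x: "x \<in> M" "x \<in> ball P \<delta>" for x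
  proof -
    have xf: "x \<in> frontier G" using x front by simp
    show ?thesis
      using supporting_normal_eq_gradient(1)[OF opn cvx ne xf open_ball x(2) Mb dA[OF x(2)] A0[OF x(2)]
          supporting_normal_gauss_map[OF x(1)]]
      by (simp add: sgn_div_norm divide_inverse)
  qed
  have PP: "P \<in> ball P \<delta>" using \<delta> by simp
  define \<kappa> :: real where "\<kappa> = (if gauss_map P = sgn (A P) then 1 else - 1)"
  have \<kappa>: "\<kappa> * \<kappa> = 1" "\<bar>\<kappa>\<bar> = 1" by (auto simp: \<kappa>_def)
  define V where "V x = \<kappa> *\<^sub>R sgn (A x)" for x
  define DV where "DV x h = \<kappa> *\<^sub>R (inverse (norm (A x)) *\<^sub>R B x h
      + (- (inverse (norm (A x)) * (sgn (A x) \<bullet> B x h) * inverse (norm (A x)))) *\<^sub>R A x)" for x h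
  have contA: "continuous_on (ball P \<delta>) A"
    using has_derivative_continuous[OF dB] by (intro continuous_at_imp_continuous_on) blast
  have contV: "continuous_on (ball P \<delta>) V"
    unfolding V_def using A0 by (intro continuous_intros contA) auto
  have normV: "norm (V x) = 1" if "x \<in> ball P \<delta>" for x
    using A0[OF that] \<kappa> by (simp add: V_def norm_sgn)
  have VP: "gauss_map P = V P" using sgn[OF P PP] by (auto simp: V_def \<kappa>_def)
  have V_or: "gauss_map x = V x \<or> gauss_map x = - V x" if "x \<in> M" "x \<in> ball P \<delta>" for x
    using sgn[OF that] by (auto simp: V_def \<kappa>_def)
  have "continuous_on (M \<inter> ball P \<delta>) (\<lambda>x. gauss_map x \<bullet> V x)"
    by (intro continuous_intros continuous_on_subset[OF contV] continuous_on_subset[OF continuous_on_gauss_map]) auto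
  moreover have NVP: "gauss_map P \<bullet> V P = 1" using norm_gauss_map[OF P] by (simp add: VP[symmetric] dot_square_norm)
  ultimately obtain d where d: "d > 0"
    "\<And>x. x \<in> M \<inter> ball P \<delta> \<Longrightarrow> dist x P < d \<Longrightarrow> dist (gauss_map x \<bullet> V x) 1 < 1"
    using P PP unfolding continuous_on_iff by (metis Int_iff zero_less_one)
  have NV: "gauss_map x = V x" if x: "x \<in> M" "x \<in> ball P \<delta>" "dist x P < d" for x
  proof (rule ccontr)
    assume "gauss_map x \<noteq> V x"
    then have "gauss_map x = - V x" using V_or x by blast
    then have "gauss_map x \<bullet> V x = - 1" using normV[OF x(2)] by (simp add: dot_square_norm)
    then show False using d(2)[of x] x by (simp add: dist_real_def)
  qed
  define e where "e = min \<delta> d"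
  have sub: "ball P e \<subseteq> ball P \<delta>" by (auto simp: e_def)
  have "normal_extension P e V DV"
    unfolding normal_extension_def
  proof (intro conjI ballI allI impI)
    show "e > 0" using \<delta> d by (simp add: e_def)
    show "(V has_derivative DV x) (at x)" if "x \<in> ball P e" for x
    proof -
      have x: "x \<in> ball P \<delta>" using that sub by blast
      have "((\<lambda>x. norm (A x)) has_derivative (\<lambda>h. sgn (A x) \<bullet> B x h)) (at x)"
        using has_derivative_compose[OF dB[OF x] has_derivative_norm[OF A0[OF x]]]
        by (simp add: inner_commute)
      from Deriv.has_derivative_inverse[OF _ this] A0[OF x]
      have "((\<lambda>x. inverse (norm (A x))) has_derivative
          (\<lambda>h. - (inverse (norm (A x)) * (sgn (A x) \<bullet> B x h) * inverse (norm (A x))))) (at x)"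
        by simp
      from has_derivative_scaleR_right[OF has_derivative_scaleR[OF this dB[OF x]], of \<kappa>]
      show ?thesis unfolding V_def[abs_def] DV_def[abs_def] sgn_div_norm .
    qed
    show "continuous_on (ball P e) (\<lambda>x. DV x k)" for k
      unfolding DV_def using A0 sub
      by (intro continuous_intros continuous_on_subset[OF contA sub] continuous_on_subset[OF cB sub]) auto
    show "norm (V x) = 1" if "x \<in> ball P e" for x using normV that sub by blast
    show "gauss_map x = V x" if "x \<in> M \<inter> ball P e" for x
      using NV that sub by (auto simp: e_def dist_commute)
    show "DV x v \<bullet> w = v \<bullet> DV x w"
      if Mx: "x \<in> M \<inter> ball P e" and vw: "v \<bullet> gauss_map x = 0" "w \<bullet> gauss_map x = 0" for x v w
    proof -
      have x: "x \<in> M" and xd: "x \<in> ball P \<delta>" using Mx sub by blast+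
      have "v \<bullet> A x = 0" "w \<bullet> A x = 0"
        using vw sgn[OF x xd] A0[OF xd] by (auto simp: sgn_div_norm)
      then show ?thesis using sym[OF xd, of v w]
        by (simp add: DV_def inner_diff_left inner_diff_right inner_add_left inner_add_right inner_commute[of "A x"])
    qed
  qed
  then show ?thesis by blast
qed

section \<open>The two graphs bounding a convex body\<close>

definition \<Omega> :: "'b set" where "\<Omega> = fst ` G"

text \<open>For \<open>\<sigma> = 1\<close> this is the upper end and for \<open>\<sigma> = -1\<close> the lower end of the vertical chord over \<open>x\<close>.
Carrying the sign \<open>\<sigma>\<close> treats both graphs at once.\<close>

definition height :: "real \<Rightarrow> 'b \<Rightarrow> real" where
  "height \<sigma> x = (SOME t. (x, t) \<in> closure G \<and> (\<forall>t'. (x, t') \<in> closure G \<longrightarrow> \<sigma> * t' \<le> \<sigma> * t))"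

lemma open_\<Omega>: "open \<Omega>" unfolding \<Omega>_def by (rule open_image_fst[OF opn])

lemma convex_\<Omega>: "convex \<Omega>" unfolding \<Omega>_def by (rule convex_linear_image[OF linear_fst cvx])

lemma bounded_\<Omega>: "bounded \<Omega>" unfolding \<Omega>_def by (rule bounded_fst[OF bdd])

lemma \<Omega>_nonempty: "\<Omega> \<noteq> {}" using ne by (simp add: \<Omega>_def)

lemma height_max:
  assumes x: "x \<in> \<Omega>"
  shows "(x, height \<sigma> x) \<in> closure G" and "(x, t) \<in> closure G \<Longrightarrow> \<sigma> * t \<le> \<sigma> * height \<sigma> x"
proof -
  define S where "S = closure G \<inter> ({x} \<times> UNIV)"
  have "compact S" unfolding S_def using bdd
    by (intro compact_Int_closed closed_Times) (auto simp: compact_closure)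
  moreover have "S \<noteq> {}" using x closure_subset[of G] by (auto simp: S_def \<Omega>_def)
  moreover have "continuous_on S (\<lambda>p. \<sigma> * snd p)" by (intro continuous_intros)
  ultimately obtain p where p: "p \<in> S" "\<forall>q\<in>S. \<sigma> * snd q \<le> \<sigma> * snd p"
    using continuous_attains_sup by blast
  have "(x, snd p) \<in> closure G \<and> (\<forall>t'. (x, t') \<in> closure G \<longrightarrow> \<sigma> * t' \<le> \<sigma> * snd p)"
  proof (intro conjI allI impI)
    show "(x, snd p) \<in> closure G" using p(1) by (auto simp: S_def)
    show "\<sigma> * t' \<le> \<sigma> * snd p" if "(x, t') \<in> closure G" for t'
      using bspec[OF p(2), of "(x, t')"] that by (simp add: S_def)
  qed
  from someI[of "\<lambda>t. (x, t) \<in> closure G \<and> (\<forall>t'. (x, t') \<in> closure G \<longrightarrow> \<sigma> * t' \<le> \<sigma> * t)", OF this]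
  show "(x, height \<sigma> x) \<in> closure G" "(x, t) \<in> closure G \<Longrightarrow> \<sigma> * t \<le> \<sigma> * height \<sigma> x"
    unfolding height_def by blast+
qed

lemma height_in_M:
  assumes x: "x \<in> \<Omega>" and \<sigma>: "\<sigma> = 1 \<or> \<sigma> = -1"
  shows "(x, height \<sigma> x) \<in> M"
proof -
  have "(x, height \<sigma> x) \<notin> G"
  proof
    assume "(x, height \<sigma> x) \<in> G"
    then obtain r where r: "r > 0" "ball (x, height \<sigma> x) r \<subseteq> G" using opn open_contains_ball by blast
    have "(x, height \<sigma> x) + (0, \<sigma> * (r / 2)) \<in> G"
      using r \<sigma> by (intro ball_add_mem[OF r(2)]) (auto simp: norm_Pair)
    then have "(x, height \<sigma> x + \<sigma> * (r / 2)) \<in> closure G" using closure_subset by auto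
    from height_max(2)[OF x this, of \<sigma>] show False using r \<sigma> by auto
  qed
  then show ?thesis using height_max(1)[OF x] by (simp add: M_eq)
qed

lemma height_strict:
  assumes t: "(x, t) \<in> G" and \<sigma>: "\<sigma> = 1 \<or> \<sigma> = -1"
  shows "\<sigma> * t < \<sigma> * height \<sigma> x"
proof -
  have x: "x \<in> \<Omega>" using t by (force simp: \<Omega>_def)
  have "(x, t) \<in> closure G" using t closure_subset by blast
  then have "\<sigma> * t \<le> \<sigma> * height \<sigma> x" by (rule height_max(2)[OF x])
  moreover have "t \<noteq> height \<sigma> x" using height_in_M[OF x \<sigma>] t by (auto simp: M_eq)
  ultimately show ?thesis using \<sigma> by auto
qed

lemma between_heights_in_G:
  assumes x: "x \<in> \<Omega>" and t: "height (-1) x < t" "t < height 1 x"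
  shows "(x, t) \<in> G"
proof -
  obtain t0 where t0: "(x, t0) \<in> G" using x by (auto simp: \<Omega>_def)
  have h: "height (-1) x < t0" "t0 < height 1 x"
    using height_strict[OF t0, of 1] height_strict[OF t0, of "-1"] by auto
  have seg: "(x, t) \<in> G" if \<sigma>: "\<sigma> = 1 \<or> \<sigma> = -1" and l: "\<sigma> * t0 \<le> \<sigma> * t" "\<sigma> * t < \<sigma> * height \<sigma> x" for \<sigma>
  proof -
    define H where "H = height \<sigma> x"
    define e where "e = (H - t) / (H - t0)"
    have e: "0 < e" "e \<le> 1" "e * (H - t0) = H - t"
      using \<sigma> l by (auto simp: e_def H_def field_simps)
    have "(x, H) - e *\<^sub>R ((x, H) - (x, t0)) \<in> interior G"
      using t0 opn height_max(1)[OF x] e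
      by (intro mem_interior_closure_convex_shrink cvx) (auto simp: H_def interior_open)
    then show ?thesis using opn e by (simp add: interior_open)
  qed
  show ?thesis
    using seg[of 1] seg[of "-1"] t by (cases "t0 \<le> t") auto
qed

lemma M_over_\<Omega>:
  assumes "(x, t) \<in> M" "x \<in> \<Omega>"
  shows "t = height 1 x \<or> t = height (-1) x"
proof -
  have "(x, t) \<in> closure G" "(x, t) \<notin> G" using assms(1) by (auto simp: M_eq)
  then show ?thesis
    using height_max(2)[OF assms(2), of t 1] height_max(2)[OF assms(2), of t "-1"]
      between_heights_in_G[OF assms(2), of t] by fastforce
qed

definition normal_at :: "real \<Rightarrow> 'b \<Rightarrow> 'b \<times> real" where
  "normal_at \<sigma> x = gauss_map (x, height \<sigma> x)"

definition slope :: "real \<Rightarrow> 'b \<Rightarrow> 'b" where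
  "slope \<sigma> x = (- 1 / snd (normal_at \<sigma> x)) *\<^sub>R fst (normal_at \<sigma> x)"

lemma norm_normal_at:
  assumes "x \<in> \<Omega>" "\<sigma> = 1 \<or> \<sigma> = -1"
  shows "norm (normal_at \<sigma> x) = 1"
  unfolding normal_at_def by (rule norm_gauss_map[OF height_in_M[OF assms]])

lemma snd_normal_at:
  assumes x: "x \<in> \<Omega>" and \<sigma>: "\<sigma> = 1 \<or> \<sigma> = -1"
  shows "\<sigma> * snd (normal_at \<sigma> x) < 0"
proof -
  obtain t0 where t0: "(x, t0) \<in> G" using x by (auto simp: \<Omega>_def)
  have "0 < normal_at \<sigma> x \<bullet> ((x, t0) - (x, height \<sigma> x))"
    unfolding normal_at_def by (rule gauss_map_pos[OF height_in_M[OF x \<sigma>] t0])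
  also have "\<dots> = snd (normal_at \<sigma> x) * (t0 - height \<sigma> x)"
    by (simp add: inner_prod_def)
  finally show ?thesis using height_strict[OF t0 \<sigma>] \<sigma> by (auto simp: zero_less_mult_iff)
qed

lemma continuous_on_height:
  assumes \<sigma>: "\<sigma> = 1 \<or> \<sigma> = -1"
  shows "continuous_on \<Omega> (height \<sigma>)"
proof -
  have "convex_on \<Omega> (\<lambda>x. - (\<sigma> * height \<sigma> x))"
  proof (rule convex_onI)
    fix t :: real and x y assume t: "0 < t" "t < 1" and xy: "x \<in> \<Omega>" "y \<in> \<Omega>"
    let ?z = "(1 - t) *\<^sub>R x + t *\<^sub>R y"
    have z: "?z \<in> \<Omega>" using convexD[OF convex_\<Omega> xy, of "1 - t" t] t by simp
    have "(1 - t) *\<^sub>R (x, height \<sigma> x) + t *\<^sub>R (y, height \<sigma> y) \<in> closure G"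
      using t by (intro convexD[OF convex_closure[OF cvx]] height_max(1) xy) auto
    then have "(?z, (1 - t) * height \<sigma> x + t * height \<sigma> y) \<in> closure G" by simp
    from height_max(2)[OF z this, of \<sigma>]
    show "- (\<sigma> * height \<sigma> ?z) \<le> (1 - t) * - (\<sigma> * height \<sigma> x) + t * - (\<sigma> * height \<sigma> y)"
      by (simp add: algebra_simps)
  qed (rule convex_\<Omega>)
  from convex_on_continuous[OF open_\<Omega> this]
  have "continuous_on \<Omega> (\<lambda>x. - \<sigma> * - (\<sigma> * height \<sigma> x))" by (rule continuous_on_mult_left)
  then show ?thesis by (rule continuous_on_eq) (use \<sigma> in auto)
qed

lemma continuous_on_lift:
  assumes "\<sigma> = 1 \<or> \<sigma> = -1"
  shows "continuous_on \<Omega> (\<lambda>x. (x, height \<sigma> x))"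
  by (intro continuous_intros continuous_on_height assms)

lemma continuous_on_normal_at:
  assumes \<sigma>: "\<sigma> = 1 \<or> \<sigma> = -1"
  shows "continuous_on \<Omega> (normal_at \<sigma>)"
  unfolding normal_at_def
  by (rule continuous_on_compose2[OF continuous_on_gauss_map continuous_on_lift[OF \<sigma>]])
    (use height_in_M \<sigma> in auto)

lemma continuous_on_slope:
  assumes \<sigma>: "\<sigma> = 1 \<or> \<sigma> = -1"
  shows "continuous_on \<Omega> (slope \<sigma>)"
  unfolding slope_def using snd_normal_at[OF _ \<sigma>]
  by (intro continuous_intros continuous_on_normal_at \<sigma>) fastforce

lemma height_below_tangent:
  assumes xy: "x \<in> \<Omega>" "y \<in> \<Omega>" and \<sigma>: "\<sigma> = 1 \<or> \<sigma> = -1"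
  shows "\<sigma> * (height \<sigma> y - height \<sigma> x) \<le> \<sigma> * (slope \<sigma> x \<bullet> (y - x))"
proof -
  let ?n = "normal_at \<sigma> x"
  have "0 \<le> ?n \<bullet> ((y, height \<sigma> y) - (x, height \<sigma> x))"
    unfolding normal_at_def by (rule gauss_map_closure_nonneg[OF height_in_M[OF xy(1) \<sigma>] height_max(1)[OF xy(2)]])
  then have *: "0 \<le> fst ?n \<bullet> (y - x) + snd ?n * (height \<sigma> y - height \<sigma> x)"
    by (simp add: inner_prod_def)
  have s: "\<sigma> * snd ?n < 0" by (rule snd_normal_at[OF xy(1) \<sigma>])
  have "slope \<sigma> x \<bullet> (y - x) = - (fst ?n \<bullet> (y - x)) / snd ?n" by (simp add: slope_def)
  then show ?thesis using * s \<sigma> by (auto simp: field_simps)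
qed

text \<open>Concavity replaces the implicit function theorem: the supporting hyperplanes at \<open>x\<close> and at a nearby \<open>y\<close> enclose
the increment between \<open>slope \<sigma> x \<bullet> (y - x)\<close> and \<open>slope \<sigma> y \<bullet> (y - x)\<close>, and the slope is
continuous.\<close>

lemma height_has_derivative:
  assumes x: "x \<in> \<Omega>" and \<sigma>: "\<sigma> = 1 \<or> \<sigma> = -1"
  shows "(height \<sigma> has_derivative (\<lambda>h. slope \<sigma> x \<bullet> h)) (at x)"
  unfolding has_derivative_at_alt
proof (intro conjI allI impI)
  show "bounded_linear ((\<bullet>) (slope \<sigma> x))" by (rule bounded_linear_inner_right)
  fix e :: real assume e: "e > 0"
  have "isCont (slope \<sigma>) x"
    using continuous_on_slope[OF \<sigma>] open_\<Omega> x by (simp add: continuous_on_eq_continuous_at)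
  then obtain d where d: "d > 0" "\<And>y. dist y x < d \<Longrightarrow> dist (slope \<sigma> y) (slope \<sigma> x) < e"
    using e unfolding continuous_at_eps_delta by meson
  obtain r where r: "r > 0" "ball x r \<subseteq> \<Omega>" using open_\<Omega> x open_contains_ball by blast
  show "\<exists>d>0. \<forall>y. norm (y - x) < d \<longrightarrow>
      norm (height \<sigma> y - height \<sigma> x - slope \<sigma> x \<bullet> (y - x)) \<le> e * norm (y - x)"
  proof (intro exI[of _ "min d r"] conjI allI impI)
    fix y assume "norm (y - x) < min d r"
    then have y: "y \<in> \<Omega>" "dist y x < d" using r(2) by (auto simp: dist_norm norm_minus_commute)
    have "\<sigma> * (height \<sigma> y - height \<sigma> x) \<le> \<sigma> * (slope \<sigma> x \<bullet> (y - x))"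
      by (rule height_below_tangent[OF x y(1) \<sigma>])
    moreover have "\<sigma> * (height \<sigma> x - height \<sigma> y) \<le> \<sigma> * (slope \<sigma> y \<bullet> (x - y))"
      by (rule height_below_tangent[OF y(1) x \<sigma>])
    moreover have "slope \<sigma> y \<bullet> (x - y) = - (slope \<sigma> y \<bullet> (y - x))" by (simp add: inner_diff_right)
    ultimately have "\<bar>height \<sigma> y - height \<sigma> x - slope \<sigma> x \<bullet> (y - x)\<bar>
        \<le> \<bar>slope \<sigma> y \<bullet> (y - x) - slope \<sigma> x \<bullet> (y - x)\<bar>"
      using \<sigma> by auto
    also have "\<dots> = \<bar>(slope \<sigma> y - slope \<sigma> x) \<bullet> (y - x)\<bar>" by (simp add: inner_diff_left)
    also have "\<dots> \<le> norm (slope \<sigma> y - slope \<sigma> x) * norm (y - x)" by (rule Cauchy_Schwarz_ineq2)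
    also have "\<dots> \<le> e * norm (y - x)"
      using d(2)[OF y(2)] by (intro mult_right_mono) (auto simp: dist_norm)
    finally show "norm (height \<sigma> y - height \<sigma> x - slope \<sigma> x \<bullet> (y - x)) \<le> e * norm (y - x)" by simp
  qed (use d r in auto)
qed

lemma inner_normal_graph:
  assumes x: "x \<in> \<Omega>" and \<sigma>: "\<sigma> = 1 \<or> \<sigma> = -1"
  shows "v \<bullet> normal_at \<sigma> x = 0 \<longleftrightarrow> snd v = slope \<sigma> x \<bullet> fst v"
proof -
  have "snd (normal_at \<sigma> x) \<noteq> 0" using snd_normal_at[OF x \<sigma>] by auto
  then show ?thesis
    by (auto simp: inner_prod_def slope_def field_simps inner_commute eq_neg_iff_add_eq_0 add.commute)
qed

text \<open>A curve in the hypersurface minimizes its distance to the supporting hyperplane at \<open>t = 0\<close>, so its velocity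
is orthogonal to the normal; conversely lines in \<open>\<Omega>\<close> lift to curves in the graph.\<close>

lemma tangent_space_graph:
  assumes x: "x \<in> \<Omega>" and \<sigma>: "\<sigma> = 1 \<or> \<sigma> = -1"
  shows "tangent_space M (x, height \<sigma> x) = {v. v \<bullet> normal_at \<sigma> x = 0}"
proof (intro set_eqI iffI)
  let ?P = "(x, height \<sigma> x)"
  have PM: "?P \<in> M" by (rule height_in_M[OF x \<sigma>])
  fix v assume "v \<in> tangent_space M ?P"
  then obtain \<gamma> e where e: "e > 0" and \<gamma>: "\<And>t. \<bar>t\<bar> < e \<Longrightarrow> \<gamma> t \<in> M" "\<gamma> 0 = ?P"
    and d: "(\<gamma> has_vector_derivative v) (at (0::real))"
    unfolding tangent_space_def by blast
  have "((\<lambda>t. gauss_map ?P \<bullet> (\<gamma> t - ?P)) has_real_derivative gauss_map ?P \<bullet> v) (at 0)"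
    using d by (auto simp: has_vector_derivative_def has_field_derivative_def mult.commute
        intro!: derivative_eq_intros)
  moreover have "\<forall>t. \<bar>0 - t\<bar> < e \<longrightarrow> gauss_map ?P \<bullet> (\<gamma> 0 - ?P) \<le> gauss_map ?P \<bullet> (\<gamma> t - ?P)"
  proof (intro allI impI)
    fix t assume "\<bar>0 - t\<bar> < e"
    then have "\<gamma> t \<in> closure G" using \<gamma>(1)[of t] by (simp add: M_eq)
    from gauss_map_closure_nonneg[OF PM this] show "gauss_map ?P \<bullet> (\<gamma> 0 - ?P) \<le> gauss_map ?P \<bullet> (\<gamma> t - ?P)"
      by (simp add: \<gamma>(2))
  qed
  ultimately have "gauss_map ?P \<bullet> v = 0" using e DERIV_local_min by blast
  then show "v \<in> {v. v \<bullet> normal_at \<sigma> x = 0}" by (simp add: normal_at_def inner_commute)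
next
  let ?P = "(x, height \<sigma> x)"
  fix v assume "v \<in> {v. v \<bullet> normal_at \<sigma> x = 0}"
  then have v: "snd v = slope \<sigma> x \<bullet> fst v" using inner_normal_graph[OF x \<sigma>] by simp
  obtain r where r: "r > 0" "ball x r \<subseteq> \<Omega>" using open_\<Omega> x open_contains_ball by blast
  define e where "e = r / (norm (fst v) + 1)"
  have nv: "norm (fst v) + 1 > 0" by (simp add: add_nonneg_pos)
  have e: "e > 0" using r nv by (simp add: e_def)
  define \<gamma> where "\<gamma> t = (x + t *\<^sub>R fst v, height \<sigma> (x + t *\<^sub>R fst v))" for t
  have "\<gamma> t \<in> M" if "\<bar>t\<bar> < e" for t
  proof -
    have "\<bar>t\<bar> * norm (fst v) \<le> \<bar>t\<bar> * (norm (fst v) + 1)" by (intro mult_left_mono) auto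
    also have "\<dots> < r" using that nv by (simp add: e_def pos_less_divide_eq)
    finally have "x + t *\<^sub>R fst v \<in> \<Omega>" by (intro ball_add_mem[OF r(2)]) simp
    then show ?thesis unfolding \<gamma>_def by (rule height_in_M[OF _ \<sigma>])
  qed
  moreover have "(\<gamma> has_vector_derivative v) (at 0)"
  proof -
    have l: "((\<lambda>t. x + t *\<^sub>R fst v) has_derivative (\<lambda>t. t *\<^sub>R fst v)) (at 0)"
      by (auto intro!: derivative_eq_intros)
    have "((\<lambda>t. height \<sigma> (x + t *\<^sub>R fst v)) has_derivative (\<lambda>t. slope \<sigma> x \<bullet> (t *\<^sub>R fst v))) (at 0)"
      using has_derivative_compose[OF l, of "height \<sigma>" "\<lambda>h. slope \<sigma> x \<bullet> h"] height_has_derivative[OF x \<sigma>]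
      by simp
    from has_derivative_Pair[OF l this]
    have "(\<gamma> has_derivative (\<lambda>t. (t *\<^sub>R fst v, slope \<sigma> x \<bullet> (t *\<^sub>R fst v)))) (at 0)"
      by (simp add: \<gamma>_def[abs_def])
    moreover have "(\<lambda>t. (t *\<^sub>R fst v, slope \<sigma> x \<bullet> (t *\<^sub>R fst v))) = (\<lambda>t. t *\<^sub>R v)"
      using v by (auto simp: fun_eq_iff prod_eq_iff)
    ultimately show ?thesis by (simp add: has_vector_derivative_def)
  qed
  ultimately show "v \<in> tangent_space M ?P"
    unfolding tangent_space_def using e by (auto intro!: exI[of _ \<gamma>] exI[of _ e] simp: \<gamma>_def)
qed

text \<open>Over \<open>\<Omega>\<close> the tangent space is a full hyperplane, so orthogonality determines the normal up to sign, and
the requirement to point into \<open>G\<close> selects the supporting one.\<close>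

lemma inner_unit_normal_eq_gauss_map:
  assumes P: "P \<in> M" and x: "fst P \<in> \<Omega>"
  shows "inner_unit_normal M G P = gauss_map P"
proof -
  obtain \<sigma> where \<sigma>: "\<sigma> = 1 \<or> \<sigma> = -1" and P_eq: "P = (fst P, height \<sigma> (fst P))"
    using M_over_\<Omega>[of "fst P" "snd P"] P x by (metis prod.collapse)
  have NP: "normal_at \<sigma> (fst P) = gauss_map P" unfolding normal_at_def using P_eq by simp
  have T: "tangent_space M P = {v. v \<bullet> gauss_map P = 0}"
    using tangent_space_graph[OF x \<sigma>] P_eq NP by simp
  have n1: "gauss_map P \<bullet> gauss_map P = 1" using norm_gauss_map[OF P] by (simp add: dot_square_norm)
  show ?thesis
    unfolding inner_unit_normal_def
  proof (rule the_equality)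
    show "norm (gauss_map P) = 1 \<and> (\<forall>v\<in>tangent_space M P. gauss_map P \<bullet> v = 0) \<and>
        (\<exists>e>0. \<forall>t. 0 < t \<and> t < e \<longrightarrow> P + t *\<^sub>R gauss_map P \<in> G)"
      using norm_gauss_map[OF P] gauss_map_points_inside[OF P] by (simp add: T inner_commute)
  next
    fix \<nu> assume \<nu>: "norm \<nu> = 1 \<and> (\<forall>v\<in>tangent_space M P. \<nu> \<bullet> v = 0) \<and>
        (\<exists>e>0. \<forall>t. 0 < t \<and> t < e \<longrightarrow> P + t *\<^sub>R \<nu> \<in> G)"
    define k where "k = \<nu> \<bullet> gauss_map P"
    define v where "v = \<nu> - k *\<^sub>R gauss_map P"
    have vN: "v \<bullet> gauss_map P = 0" using n1 by (simp add: v_def inner_diff_left k_def)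
    moreover have "\<forall>v\<in>tangent_space M P. \<nu> \<bullet> v = 0" using \<nu> by blast
    ultimately have "\<nu> \<bullet> v = 0" unfolding T by blast
    then have "v \<bullet> v = 0" using vN by (simp add: v_def inner_diff_left inner_commute)
    then have \<nu>k: "\<nu> = k *\<^sub>R gauss_map P" by (simp add: v_def)
    then have "\<bar>k\<bar> = 1" using \<nu> norm_gauss_map[OF P] by simp
    moreover have "k > 0"
    proof -
      obtain e where e: "e > 0" "\<forall>t. 0 < t \<and> t < e \<longrightarrow> P + t *\<^sub>R \<nu> \<in> G" using \<nu> by blast
      then have "P + (e / 2) *\<^sub>R \<nu> \<in> G" by simp
      from gauss_map_pos[OF P this] have "0 < (e / 2) * k" by (simp add: k_def inner_commute)
      then show ?thesis using e by (simp add: zero_less_mult_iff)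
    qed
    ultimately have "k = 1" by linarith
    then show "\<nu> = gauss_map P" by (simp add: \<nu>k)
  qed
qed

section \<open>The mean curvature as a divergence\<close>

definition Dnormal :: "real \<Rightarrow> 'b \<Rightarrow> 'b \<Rightarrow> 'b \<times> real" where
  "Dnormal \<sigma> x = frechet_derivative (normal_at \<sigma>) (at x)"

lemma normal_at_local:
  assumes x0: "x0 \<in> \<Omega>" and \<sigma>: "\<sigma> = 1 \<or> \<sigma> = -1"
    and ext: "normal_extension (x0, height \<sigma> x0) \<delta> V DV"
  shows "\<exists>U. open U \<and> x0 \<in> U \<and> U \<subseteq> \<Omega> \<and> (\<forall>x\<in>U. (x, height \<sigma> x) \<in> ball (x0, height \<sigma> x0) \<delta> \<and>
    (normal_at \<sigma> has_derivative (\<lambda>h. DV (x, height \<sigma> x) (h, slope \<sigma> x \<bullet> h))) (at x))"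
proof -
  note V = normal_extensionD(3)[OF ext] and NV = normal_extensionD(6)[OF ext]
  define U where "U = \<Omega> \<inter> (\<lambda>x. (x, height \<sigma> x)) -` ball (x0, height \<sigma> x0) \<delta>"
  have U: "open U" unfolding U_def
    by (rule continuous_open_preimage[OF continuous_on_lift[OF \<sigma>] open_\<Omega> open_ball])
  have x0U: "x0 \<in> U" using x0 normal_extensionD(2)[OF ext] by (simp add: U_def)
  show ?thesis
  proof (intro exI[of _ U] conjI ballI)
    fix x assume x: "x \<in> U"
    then have xO: "x \<in> \<Omega>" and xb: "(x, height \<sigma> x) \<in> ball (x0, height \<sigma> x0) \<delta>" by (auto simp: U_def)
    show "(x, height \<sigma> x) \<in> ball (x0, height \<sigma> x0) \<delta>" by (rule xb)
    have "((\<lambda>y. (y, height \<sigma> y)) has_derivative (\<lambda>h. (h, slope \<sigma> x \<bullet> h))) (at x)"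
      by (intro has_derivative_Pair has_derivative_ident height_has_derivative xO \<sigma>)
    from has_derivative_compose[OF this V[OF xb]]
    have "((\<lambda>y. V (y, height \<sigma> y)) has_derivative (\<lambda>h. DV (x, height \<sigma> x) (h, slope \<sigma> x \<bullet> h))) (at x)" .
    then show "(normal_at \<sigma> has_derivative (\<lambda>h. DV (x, height \<sigma> x) (h, slope \<sigma> x \<bullet> h))) (at x)"
    proof (rule has_derivative_transform_within_open[OF _ U x])
      fix y assume "y \<in> U"
      then show "V (y, height \<sigma> y) = normal_at \<sigma> y"
        unfolding normal_at_def using NV height_in_M[OF _ \<sigma>] by (auto simp: U_def)
    qed
  qed (use U x0U in \<open>auto simp: U_def\<close>)
qed

lemma Dnormal_eq:
  assumes "(normal_at \<sigma> has_derivative D) (at x)"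
  shows "Dnormal \<sigma> x = D"
  unfolding Dnormal_def using frechet_derivative_at[OF assms] by simp

lemma
  assumes x0: "x0 \<in> \<Omega>" and \<sigma>: "\<sigma> = 1 \<or> \<sigma> = -1"
  shows normal_at_has_derivative: "(normal_at \<sigma> has_derivative Dnormal \<sigma> x0) (at x0)"
    and isCont_Dnormal: "isCont (\<lambda>x. Dnormal \<sigma> x k) x0"
proof -
  let ?P = "(x0, height \<sigma> x0)"
  obtain \<delta> V DV where ext: "normal_extension ?P \<delta> V DV"
    using normal_extension_exists[OF height_in_M[OF x0 \<sigma>]] by blast
  note V = normal_extensionD(3)[OF ext] and cDV = normal_extensionD(4)[OF ext]
  obtain U where U: "open U" "x0 \<in> U" "U \<subseteq> \<Omega>"
    and UU: "\<forall>x\<in>U. (x, height \<sigma> x) \<in> ball ?P \<delta> \<and>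
      (normal_at \<sigma> has_derivative (\<lambda>h. DV (x, height \<sigma> x) (h, slope \<sigma> x \<bullet> h))) (at x)"
    using normal_at_local[OF x0 \<sigma> ext] by (elim exE conjE) (rule that)
  have Ub: "(x, height \<sigma> x) \<in> ball ?P \<delta>" if "x \<in> U" for x
    using bspec[OF UU that] by (rule conjunct1)
  have Ud: "(normal_at \<sigma> has_derivative (\<lambda>h. DV (x, height \<sigma> x) (h, slope \<sigma> x \<bullet> h))) (at x)"
    if "x \<in> U" for x
    using bspec[OF UU that] by (rule conjunct2)
  show "(normal_at \<sigma> has_derivative Dnormal \<sigma> x0) (at x0)"
    unfolding Dnormal_eq[OF Ud[OF U(2)]] by (rule Ud[OF U(2)])
  have lin: "DV z (h, t) = DV z (h, 0) + t *\<^sub>R DV z (0, 1)" if "z \<in> ball ?P \<delta>" for z h t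
  proof -
    have l: "linear (DV z)" by (rule has_derivative_linear[OF V[OF that]])
    have "DV z ((h, 0) + t *\<^sub>R (0, 1)) = DV z (h, 0) + t *\<^sub>R DV z (0, 1)"
      by (simp only: linear_add[OF l] linear_cmul[OF l])
    then show ?thesis by simp
  qed
  have eq: "Dnormal \<sigma> x k = DV (x, height \<sigma> x) (k, 0) + (slope \<sigma> x \<bullet> k) *\<^sub>R DV (x, height \<sigma> x) (0, 1)"
    if "x \<in> U" for x
    unfolding Dnormal_eq[OF Ud[OF that]] by (rule lin[OF Ub[OF that]])
  have lift: "continuous_on U (\<lambda>x. DV (x, height \<sigma> x) v)" for v
    by (rule continuous_on_compose2[OF cDV continuous_on_subset[OF continuous_on_lift[OF \<sigma>] U(3)]])
      (use Ub in auto)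
  have "continuous_on U (\<lambda>x. DV (x, height \<sigma> x) (k, 0) + (slope \<sigma> x \<bullet> k) *\<^sub>R DV (x, height \<sigma> x) (0, 1))"
    by (intro continuous_intros lift continuous_on_subset[OF continuous_on_slope[OF \<sigma>] U(3)])
  then have "continuous_on U (\<lambda>x. Dnormal \<sigma> x k)"
    by (rule continuous_on_eq) (simp add: eq)
  then show "isCont (\<lambda>x. Dnormal \<sigma> x k) x0"
    using U by (simp add: continuous_on_eq_continuous_at)
qed

text \<open>A derivative within the hypersurface is not unique as a linear map. It is determined on tangent vectors,
which makes the choice hidden in \<open>frechet_derivative\<close> harmless.\<close>

lemma has_derivative_within_tangent_unique:
  fixes f :: "'b \<times> real \<Rightarrow> 'b \<times> real"
  assumes 1: "(f has_derivative D1) (at P within M)" and 2: "(f has_derivative D2) (at P within M)"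
    and v: "v \<in> tangent_space M P"
  shows "D1 v = D2 v"
proof -
  obtain \<gamma> e where e: "e > 0" and \<gamma>: "\<And>t. \<bar>t\<bar> < e \<Longrightarrow> \<gamma> t \<in> M" "\<gamma> 0 = P"
    and d: "(\<gamma> has_vector_derivative v) (at (0::real))"
    using v unfolding tangent_space_def by blast
  have along: "((\<lambda>t. f (\<gamma> t)) has_vector_derivative D v) (at 0)"
    if D: "(f has_derivative D) (at P within M)" for D
  proof -
    let ?S = "ball (0::real) e"
    have "(\<gamma> has_derivative (\<lambda>t. t *\<^sub>R v)) (at 0 within ?S)"
      using d unfolding has_vector_derivative_def by (rule has_derivative_at_withinI)
    moreover have "(f has_derivative D) (at (\<gamma> 0) within \<gamma> ` ?S)"
      unfolding \<gamma>(2) by (rule has_derivative_subset[OF D]) (use \<gamma>(1) in auto)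
    ultimately have "(f \<circ> \<gamma> has_derivative D \<circ> (\<lambda>t. t *\<^sub>R v)) (at 0 within ?S)"
      by (rule diff_chain_within)
    moreover have "D \<circ> (\<lambda>t. t *\<^sub>R v) = (\<lambda>t. t *\<^sub>R D v)"
      using has_derivative_linear[OF D] by (simp add: fun_eq_iff linear_cmul)
    ultimately show ?thesis
      using e by (simp add: has_vector_derivative_def o_def at_within_open[OF _ open_ball])
  qed
  show ?thesis by (rule vector_derivative_unique_at[OF along[OF 1] along[OF 2]])
qed

text \<open>On the tangent space the shape operator agrees with \<open>- D\<close>, where \<open>D\<close> differentiates the normal as a
function of the horizontal coordinates alone. Adding the normal vector to an orthonormal basis of the tangent
space does not change the trace, because the derivative of a unit vector field is orthogonal to the field.
So the trace may be computed in the standard basis, where the vertical direction contributes nothing and the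
horizontal directions give the divergence.\<close>

lemma mean_curvature_eq_divergence:
  assumes x: "x \<in> \<Omega>" and \<sigma>: "\<sigma> = 1 \<or> \<sigma> = -1"
  shows "mean_curvature M G (x, height \<sigma> x) = - (\<Sum>b\<in>Basis. fst (Dnormal \<sigma> x b) \<bullet> b) / real DIM('b)"
proof -
  let ?P = "(x, height \<sigma> x)"
  let ?n = "normal_at \<sigma> x"
  have PM: "?P \<in> M" by (rule height_in_M[OF x \<sigma>])
  obtain \<delta> V DV where ext: "normal_extension ?P \<delta> V DV"
    using normal_extension_exists[OF PM] by blast
  note V = normal_extensionD(3)[OF ext] and nV = normal_extensionD(5)[OF ext]
    and NV = normal_extensionD(6)[OF ext] and sym = normal_extensionD(7)[OF ext]
    and PP = normal_extensionD(2)[OF ext]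
  have "(normal_at \<sigma> has_derivative (\<lambda>h. DV ?P (h, slope \<sigma> x \<bullet> h))) (at x)"
    using normal_at_local[OF x \<sigma> ext] by blast
  then have Dn: "Dnormal \<sigma> x h = DV ?P (h, slope \<sigma> x \<bullet> h)" for h
    by (simp add: Dnormal_eq)
  define T where "T = {v. v \<bullet> ?n = 0}"
  have T: "tangent_space M ?P = T" unfolding T_def by (rule tangent_space_graph[OF x \<sigma>])
  have T_sub: "subspace T" using subspace_hyperplane[of ?n] by (simp add: T_def inner_commute)
  have n1: "?n \<bullet> ?n = 1" using norm_normal_at[OF x \<sigma>] by (simp add: dot_square_norm)
  define L where "L v = - DV ?P v" for v
  define D where "D v = Dnormal \<sigma> x (fst v)" for v :: "'b \<times> real"
  have linV: "linear (DV ?P)" by (rule has_derivative_linear[OF V[OF PP]])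
  have linL: "linear L" unfolding L_def[abs_def] by (rule linear_compose_neg[OF linV])
  have linDn: "linear (Dnormal \<sigma> x)"
    by (rule has_derivative_linear[OF normal_at_has_derivative[OF x \<sigma>]])
  have linD: "linear D"
    unfolding D_def[abs_def] using linear_compose[OF linear_fst linDn] by (simp add: o_def)
  have LD: "L v = - D v" if "v \<in> T" for v
    using that inner_normal_graph[OF x \<sigma>, of v] by (simp add: L_def D_def Dn T_def) (metis prod.collapse)
  have orth: "DV ?P v \<bullet> ?n = 0" for v
  proof -
    have d1: "((\<lambda>z. V z \<bullet> V z) has_derivative (\<lambda>h. V ?P \<bullet> DV ?P h + DV ?P h \<bullet> V ?P)) (at ?P)"
      by (intro has_derivative_inner V PP)
    have d2: "((\<lambda>z. V z \<bullet> V z) has_derivative (\<lambda>h. 0)) (at ?P)"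
      by (rule has_derivative_transform_within_open[OF has_derivative_const[of 1] open_ball PP])
        (simp add: dot_square_norm nV)
    have "V ?P \<bullet> DV ?P v + DV ?P v \<bullet> V ?P = 0"
      using fun_cong[OF has_derivative_unique[OF d1 d2], of v] .
    then show ?thesis using NV[OF PM PP] by (simp add: normal_at_def inner_commute)
  qed
  have shape: "shape_operator M G ?P v = L v" if v: "v \<in> T" for v
  proof -
    have "open (\<Omega> \<times> (UNIV :: real set))" by (intro open_Times open_\<Omega> open_UNIV)
    then have "open (ball ?P \<delta> \<inter> \<Omega> \<times> UNIV)" by (intro open_Int open_ball)
    moreover have "?P \<in> ball ?P \<delta> \<inter> \<Omega> \<times> UNIV" using PP x by simp
    ultimately obtain r where r: "r > 0" "ball ?P r \<subseteq> ball ?P \<delta> \<inter> \<Omega> \<times> UNIV"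
      using open_contains_ball by blast
    have der: "(inner_unit_normal M G has_derivative DV ?P) (at ?P within M)"
    proof (rule has_derivative_transform_within[OF has_derivative_at_withinI[OF V[OF PP]] r(1) PM])
      fix z assume z: "z \<in> M" "dist z ?P < r"
      then have "z \<in> ball ?P r" by (simp add: dist_commute)
      then have zb: "z \<in> ball ?P \<delta>" "z \<in> \<Omega> \<times> UNIV" using r(2) by blast+
      have "fst z \<in> \<Omega>" using zb(2) by (auto simp: mem_Times_iff)
      then show "V z = inner_unit_normal M G z" using inner_unit_normal_eq_gauss_map[OF z(1)] NV[OF z(1) zb(1)] by simp
    qed
    then have "inner_unit_normal M G differentiable (at ?P within M)" by (rule differentiableI)
    then have "(inner_unit_normal M G has_derivative
        frechet_derivative (inner_unit_normal M G) (at ?P within M)) (at ?P within M)"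
      by (simp add: frechet_derivative_works)
    from has_derivative_within_tangent_unique[OF this der] v
    show ?thesis by (simp add: shape_operator_def L_def T)
  qed
  have LT: "L v \<in> T" for v using orth[of v] by (simp add: T_def L_def)
  have Lsym: "L v \<bullet> w = v \<bullet> L w" if "v \<in> T" "w \<in> T" for v w
    using sym[OF PM PP, of v w] that by (simp add: T_def L_def normal_at_def)
  obtain E where E: "E \<subseteq> T" "pairwise orthogonal E"
      "\<forall>e\<in>E. norm e = 1 \<and> (\<exists>k. L e = k *\<^sub>R e)" "span E = T"
    using symmetric_orthonormal_eigenbasis[OF linL T_sub LT Lsym] by blast
  have En: "norm e = 1" and Ek: "\<exists>k. L e = k *\<^sub>R e" if "e \<in> E" for e using E(3) that by auto
  have ps: "principal_space M G ?P k = {v \<in> span E. L v = k *\<^sub>R v}" for k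
    unfolding principal_space_def T E(4) using shape by auto
  have "(\<Sum>k\<in>principal_curvatures M G ?P. real (dim (principal_space M G ?P k)) * k) = (\<Sum>e\<in>E. L e \<bullet> e)"
    unfolding principal_curvatures_def ps
    by (rule sum_eigenvalues_with_multiplicity[OF E(2) En linL Ek])
  also have "\<dots> = - (\<Sum>e\<in>E. D e \<bullet> e)"
    unfolding sum_negf[symmetric] using LD E(1) by (intro sum.cong refl) auto
  also have "(\<Sum>e\<in>E. D e \<bullet> e) = (\<Sum>e\<in>insert ?n E. D e \<bullet> e)"
  proof -
    have "?n \<notin> E" using E(1) n1 by (auto simp: T_def)
    moreover have "finite E" using E(2) En
      by (metis independent_bound_general norm_zero pairwise_orthogonal_independent zero_neq_one)
    moreover have "D ?n \<bullet> ?n = 0" using orth by (simp add: D_def Dn)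
    ultimately show ?thesis by simp
  qed
  also have "\<dots> = (\<Sum>b\<in>Basis. D b \<bullet> b)"
  proof (rule trace_orthonormal_basis[OF linD])
    show "pairwise orthogonal (insert ?n E)"
      using E(1,2) by (auto simp: pairwise_insert orthogonal_def T_def inner_commute)
    show "norm e = 1" if "e \<in> insert ?n E" for e
      using that norm_normal_at[OF x \<sigma>] by (elim insertE) (simp_all only: En)
    have "v \<in> span (insert ?n E)" for v
    proof -
      have "v - (v \<bullet> ?n) *\<^sub>R ?n \<in> span E" using n1 by (simp add: E(4) T_def inner_diff_left)
      then show ?thesis unfolding span_insert by blast
    qed
    then show "span (insert ?n E) = UNIV" by blast
  qed
  also have "\<dots> = (\<Sum>b\<in>Basis. fst (Dnormal \<sigma> x b) \<bullet> b)"
  proof -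
    have "Dnormal \<sigma> x 0 = 0" by (rule linear_0[OF linDn])
    then show ?thesis
      unfolding Basis_prod_def
      by (subst sum.union_disjoint) (auto simp: sum.reindex inj_on_def D_def inner_prod_def)
  qed
  finally show ?thesis by (simp add: mean_curvature_def)
qed

section \<open>Comparing the two graphs\<close>

text \<open>Over a boundary point of \<open>\<Omega>\<close> a supporting hyperplane of \<open>\<Omega>\<close>, extended vertically, supports the body
at every point of the fibre, and supporting normals are unique.\<close>

lemma gauss_map_eq_on_vertical_fibre:
  assumes P: "P \<in> M" and Q: "Q \<in> M" and PQ: "fst P = fst Q" and x: "fst P \<notin> \<Omega>"
  shows "gauss_map P = gauss_map Q"
proof -
  obtain a b where ab: "a \<noteq> 0" "\<forall>z\<in>{fst P}. a \<bullet> z \<le> b" "\<forall>z\<in>\<Omega>. a \<bullet> z \<ge> b"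
    using separating_hyperplane_sets[of "{fst P}" \<Omega>] convex_\<Omega> \<Omega>_nonempty x by auto
  let ?n = "((1 / norm a) *\<^sub>R a, 0 :: real)"
  have supp: "supporting_normal G R ?n" if R: "fst R = fst P" for R
    unfolding supporting_normal_def
  proof (intro conjI ballI)
    show "norm ?n = 1" using ab by (simp add: norm_Pair)
    fix y assume "y \<in> G"
    then have "fst y \<in> \<Omega>" by (simp add: \<Omega>_def)
    then have "a \<bullet> fst P \<le> a \<bullet> fst y" using ab by force
    then have "0 \<le> (1 / norm a) * (a \<bullet> (fst y - fst R))"
      using R by (simp add: inner_diff_right)
    then show "0 \<le> ?n \<bullet> (y - R)" by (simp add: inner_prod_def)
  qed
  have "?n = gauss_map P" by (rule gauss_map_unique[OF P supp]) simp
  moreover have "?n = gauss_map Q" by (rule gauss_map_unique[OF Q supp]) (simp add: PQ)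
  ultimately show ?thesis by simp
qed

lemma infdist_\<Omega>_pos:
  assumes "x \<in> \<Omega>"
  shows "infdist x (- \<Omega>) > 0"
proof -
  have "closed (- \<Omega>)" using open_\<Omega> by (simp add: closed_Compl)
  then have "infdist x (- \<Omega>) \<noteq> 0"
    using in_closed_iff_infdist_zero[OF _ Compl_bounded_nonempty[OF bounded_\<Omega>], of x] assms by simp
  then show ?thesis using infdist_nonneg[of x "- \<Omega>"] by linarith
qed

text \<open>Compactness turns the preceding pointwise statement into a uniform one: pairs of points on a common vertical
line with normals at least \<open>e\<close> apart form a compact set, on which the distance to the complement of
\<open>\<Omega>\<close> has a positive minimum.\<close>

lemma normals_merge_at_boundary:
  assumes e: "e > 0"
  shows "\<exists>\<delta>>0. \<forall>x\<in>\<Omega>. infdist x (- \<Omega>) < \<delta> \<longrightarrow>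
    norm (fst (normal_at 1 x) - fst (normal_at (-1) x)) \<le> e"
proof -
  define S where "S = (M \<times> M) \<inter> {z. fst (fst z) = fst (snd z)}"
  define g where "g z = norm (fst (gauss_map (fst z)) - fst (gauss_map (snd z)))" for z
  define C where "C = S \<inter> g -` {e..}"
  have "closed {z :: ('b \<times> real) \<times> ('b \<times> real). fst (fst z) = fst (snd z)}"
    by (intro closed_Collect_eq continuous_intros)
  then have S: "compact S" unfolding S_def by (intro compact_Int_closed compact_Times compact_M)
  have "continuous_on S g"
    unfolding g_def
    by (intro continuous_intros continuous_on_compose2[OF continuous_on_gauss_map]) (auto simp: S_def)
  then have "closed C" unfolding C_def by (intro continuous_closed_preimage compact_imp_closed S closed_atLeast)
  then have "compact C" using S by (metis C_def closed_Int_compact inf_le1 inf.absorb_iff2 inf_commute)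
  have pos: "infdist (fst (fst z)) (- \<Omega>) > 0" if z: "z \<in> C" for z
  proof (rule infdist_\<Omega>_pos, rule ccontr)
    assume "fst (fst z) \<notin> \<Omega>"
    then have "gauss_map (fst z) = gauss_map (snd z)"
      using z by (intro gauss_map_eq_on_vertical_fibre) (auto simp: C_def S_def mem_Times_iff)
    then show False using z e by (simp add: C_def g_def)
  qed
  have "\<exists>\<delta>>0. \<forall>z\<in>C. \<delta> \<le> infdist (fst (fst z)) (- \<Omega>)"
  proof (cases "C = {}")
    case False
    have "continuous_on C (\<lambda>z. infdist (fst (fst z)) (- \<Omega>))" by (intro continuous_intros)
    from continuous_attains_inf[OF \<open>compact C\<close> False this] show ?thesis using pos by blast
  qed (auto intro: exI[of _ 1])
  then obtain \<delta> where \<delta>: "\<delta> > 0" "\<forall>z\<in>C. \<delta> \<le> infdist (fst (fst z)) (- \<Omega>)" by blast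
  have "norm (fst (normal_at 1 x) - fst (normal_at (-1) x)) \<le> e"
    if x: "x \<in> \<Omega>" "infdist x (- \<Omega>) < \<delta>" for x
  proof (rule ccontr)
    assume "\<not> ?thesis"
    then have "((x, height 1 x), (x, height (-1) x)) \<in> C"
      using height_in_M[OF x(1)] by (simp add: C_def S_def g_def normal_at_def)
    then show False using \<delta>(2) x(2) by fastforce
  qed
  then show ?thesis using \<delta>(1) by blast
qed

text \<open>Since \<open>slope 1\<close> and \<open>slope (-1)\<close> are the gradients of the upper and lower height, their sum is a difference
of gradients of the two concave functions \<open>height 1\<close> and \<open>- height (-1)\<close>, paired here with the difference of
the corresponding horizontal parts of the normals.\<close>

lemma slope_sum_inner_nonneg:
  assumes x: "x \<in> \<Omega>"
  defines "D \<equiv> (slope 1 x + slope (-1) x) \<bullet> (fst (normal_at 1 x) - fst (normal_at (-1) x))"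
  shows "D \<ge> 0" and "D = 0 \<Longrightarrow> slope 1 x + slope (-1) x = 0"
proof -
  define y1 where "y1 = fst (normal_at 1 x)"
  define y2 where "y2 = fst (normal_at (-1) x)"
  define a where "a = - snd (normal_at 1 x)"
  define b where "b = snd (normal_at (-1) x)"
  have a: "a > 0" and b: "b > 0"
    using snd_normal_at[OF x, of 1] snd_normal_at[OF x, of "-1"] by (auto simp: a_def b_def)
  have unit: "y1 \<bullet> y1 + a\<^sup>2 = 1" "y2 \<bullet> y2 + b\<^sup>2 = 1"
    using norm_normal_at[OF x, of 1] norm_normal_at[OF x, of "-1"]
    by (auto simp: norm_eq_1 inner_prod_def y1_def y2_def a_def b_def power2_eq_square)
  have s: "slope 1 x + slope (-1) x = (1 / a) *\<^sub>R y1 - (1 / b) *\<^sub>R y2"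
    by (simp add: slope_def y1_def y2_def a_def b_def)
  have D: "D = (1 / a + 1 / b) / 2 * ((norm (y1 - y2))\<^sup>2 + (a - b)\<^sup>2)"
    unfolding D_def s using graph_operator_monotone[OF a unit(1) b unit(2)] by (simp add: y1_def y2_def)
  have c: "(1 / a + 1 / b) / 2 > 0" using a b by (simp add: add_pos_pos)
  show "D \<ge> 0" unfolding D using c by (intro mult_nonneg_nonneg) auto
  assume "D = 0"
  then have "(norm (y1 - y2))\<^sup>2 + (a - b)\<^sup>2 = 0" using D c by simp
  then have "y1 = y2" "a = b" by (simp_all add: sum_power2_eq_zero_iff)
  then show "slope 1 x + slope (-1) x = 0" by (simp add: s)
qed

text \<open>The main step: the divergence of \<open>F\<close> is a sum of two nonnegative terms, the curvature comparison and the
monotonicity term, and it vanishes.\<close>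

lemma slopes_cancel:
  assumes H: "\<And>x. x \<in> \<Omega> \<Longrightarrow>
      mean_curvature M G (x, height 1 x) \<le> mean_curvature M G (x, height (-1) x)"
    and x: "x \<in> \<Omega>"
  shows "slope 1 x + slope (-1) x = 0"
proof -
  obtain B where B: "\<And>z. z \<in> closure G \<Longrightarrow> norm z \<le> B"
    using bounded_closure[OF bdd] bounded_iff by blast
  have hB: "\<bar>height \<sigma> x\<bar> \<le> B" if "x \<in> \<Omega>" for \<sigma> x
    using B[OF height_max(1)[OF that, of \<sigma>]] norm_snd_le[of "height \<sigma> x" x] by simp
  define u where "u x = height 1 x + height (-1) x + 2 * B" for x
  have u: "0 \<le> u x" "u x \<le> 4 * B" if "x \<in> \<Omega>" for x
    using hB[OF that, of 1] hB[OF that, of "-1"] by (auto simp: u_def)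
  define w where "w x = fst (normal_at 1 x) - fst (normal_at (-1) x)" for x
  define w' where "w' x k = fst (Dnormal 1 x k) - fst (Dnormal (-1) x k)" for x k
  define F where "F x = u x *\<^sub>R w x" for x
  define F' where "F' x k = u x *\<^sub>R w' x k + (slope 1 x \<bullet> k + slope (-1) x \<bullet> k) *\<^sub>R w x" for x k
  have div: "(\<Sum>b\<in>Basis. F' x b \<bullet> b)
      = u x * (\<Sum>b\<in>Basis. w' x b \<bullet> b) + (slope 1 x + slope (-1) x) \<bullet> w x" for x
  proof -
    have "(\<Sum>b\<in>Basis. (slope 1 x \<bullet> b + slope (-1) x \<bullet> b) * (w x \<bullet> b)) = (slope 1 x + slope (-1) x) \<bullet> w x"
      by (subst euclidean_inner) (simp add: inner_add_left)
    then show ?thesis by (simp add: F'_def inner_add_left sum.distrib sum_distrib_left)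
  qed
  have div_w: "0 \<le> (\<Sum>b\<in>Basis. w' x b \<bullet> b)" if "x \<in> \<Omega>" for x
  proof -
    have "- (\<Sum>b\<in>Basis. fst (Dnormal 1 x b) \<bullet> b) / real DIM('b)
        \<le> - (\<Sum>b\<in>Basis. fst (Dnormal (-1) x b) \<bullet> b) / real DIM('b)"
      using H[OF that] mean_curvature_eq_divergence[OF that] by simp
    then have "(\<Sum>b\<in>Basis. fst (Dnormal (-1) x b) \<bullet> b) \<le> (\<Sum>b\<in>Basis. fst (Dnormal 1 x b) \<bullet> b)"
      by (simp add: divide_le_cancel)
    then show ?thesis by (simp add: w'_def inner_diff_left sum_subtractf)
  qed
  have nonneg: "0 \<le> u x * (\<Sum>b\<in>Basis. w' x b \<bullet> b)" "0 \<le> (slope 1 x + slope (-1) x) \<bullet> w x" if "x \<in> \<Omega>" for x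
    using u[OF that] div_w[OF that] slope_sum_inner_nonneg(1)[OF that] by (simp_all add: w_def)
  have "(\<Sum>b\<in>Basis. F' x b \<bullet> b) = 0"
  proof (rule divergence_zero_of_nonneg[OF open_\<Omega> convex_\<Omega> bounded_\<Omega> _ _ _ _ x])
    show "(F has_derivative F' x) (at x)" if x: "x \<in> \<Omega>" for x
    proof -
      have "(u has_derivative (\<lambda>k. slope 1 x \<bullet> k + slope (-1) x \<bullet> k + 0)) (at x)"
        unfolding u_def[abs_def] by (intro has_derivative_add has_derivative_const height_has_derivative x) auto
      moreover have "(w has_derivative w' x) (at x)"
        unfolding w_def[abs_def] w'_def[abs_def]
        by (intro has_derivative_diff has_derivative_fst normal_at_has_derivative x) auto
      ultimately show ?thesis
        unfolding F_def[abs_def] F'_def[abs_def] using has_derivative_scaleR by fastforce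
    qed
    show "continuous_on \<Omega> (\<lambda>x. F' x b \<bullet> b)" for b
    proof -
      have cD: "continuous_on \<Omega> (\<lambda>x. Dnormal \<sigma> x b)" if "\<sigma> = 1 \<or> \<sigma> = -1" for \<sigma>
        using isCont_Dnormal[OF _ that] by (intro continuous_at_imp_continuous_on) blast
      show ?thesis
        unfolding F'_def u_def w'_def w_def
        by (intro continuous_on_inner continuous_on_add continuous_on_scaleR continuous_on_diff
            continuous_on_fst continuous_on_const cD continuous_on_height continuous_on_slope
            continuous_on_normal_at) auto
    qed
    show "0 \<le> (\<Sum>b\<in>Basis. F' x b \<bullet> b)" if "x \<in> \<Omega>" for x
      unfolding div using nonneg[OF that] by simp
    fix e :: real assume e: "e > 0"
    have B0: "0 \<le> B" using hB[OF x, of 1] by linarith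
    have e': "e / (4 * B + 1) > 0" using e B0 by simp
    obtain \<delta> where \<delta>: "\<delta> > 0" "\<forall>x\<in>\<Omega>. infdist x (- \<Omega>) < \<delta> \<longrightarrow> norm (w x) \<le> e / (4 * B + 1)"
      using normals_merge_at_boundary[OF e'] unfolding w_def by blast
    have "norm (F x) \<le> e" if x: "x \<in> \<Omega>" "infdist x (- \<Omega>) < \<delta>" for x
    proof -
      have "norm (F x) = u x * norm (w x)" using u[OF x(1)] by (simp add: F_def)
      also have "\<dots> \<le> (4 * B + 1) * (e / (4 * B + 1))"
        using u[OF x(1)] \<delta>(2) x B0 by (intro mult_mono) auto
      also have "\<dots> = e" using B0 by simp
      finally show ?thesis .
    qed
    then show "\<exists>\<delta>>0. \<forall>x\<in>\<Omega>. infdist x (- \<Omega>) < \<delta> \<longrightarrow> norm (F x) \<le> e" using \<delta>(1) by blast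
  qed
  then have "(slope 1 x + slope (-1) x) \<bullet> w x = 0" using nonneg[OF x] div[of x] by linarith
  then show ?thesis by (intro slope_sum_inner_nonneg(2)[OF x]) (simp add: w_def)
qed

lemma symmetric_if_heights_opposite:
  assumes c: "\<And>x. x \<in> \<Omega> \<Longrightarrow> height 1 x + height (-1) x = 2 * c"
  shows "reflect_last c ` M = M"
proof -
  have inv: "reflect_last c (reflect_last c z) = z" for z :: "'b \<times> real"
    by (simp add: reflect_last_def)
  have G: "reflect_last c z \<in> G" if z: "z \<in> G" for z
  proof -
    have x: "fst z \<in> \<Omega>" using z by (simp add: \<Omega>_def)
    have "(fst z, snd z) \<in> G" using z by simp
    from height_strict[OF this, of 1] height_strict[OF this, of "-1"] c[OF x]
    show ?thesis unfolding reflect_last_def by (intro between_heights_in_G x) auto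
  qed
  have cl: "reflect_last c ` closure G \<subseteq> closure G"
  proof (rule image_closure_subset)
    show "continuous_on (closure G) (reflect_last c)"
      unfolding reflect_last_def[abs_def] by (intro continuous_intros)
    show "reflect_last c ` G \<subseteq> closure G" using G closure_subset by blast
  qed simp
  have sub: "reflect_last c z \<in> M" if z: "z \<in> M" for z
  proof -
    have "reflect_last c z \<in> closure G" using cl z by (auto simp: M_eq)
    moreover have "reflect_last c z \<notin> G" using G[of "reflect_last c z"] z by (auto simp: inv M_eq)
    ultimately show ?thesis by (simp add: M_eq)
  qed
  show ?thesis
  proof
    show "reflect_last c ` M \<subseteq> M" using sub by blast
    show "M \<subseteq> reflect_last c ` M" using sub inv by (metis imageI subsetI)
  qed
qed

lemma symmetric_of_curvature_comparison:
  assumes H: "\<And>x. x \<in> \<Omega> \<Longrightarrow>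
      mean_curvature M G (x, height 1 x) \<le> mean_curvature M G (x, height (-1) x)"
  shows "\<exists>c. reflect_last c ` M = M"
proof -
  have "((\<lambda>x. height 1 x + height (-1) x) has_derivative (\<lambda>k. 0)) (at x within \<Omega>)" if x: "x \<in> \<Omega>" for x
  proof -
    have "((\<lambda>x. height 1 x + height (-1) x) has_derivative (\<lambda>k. slope 1 x \<bullet> k + slope (-1) x \<bullet> k)) (at x)"
      by (intro has_derivative_add height_has_derivative x) auto
    moreover have "slope 1 x \<bullet> k + slope (-1) x \<bullet> k = 0" for k
      using slopes_cancel[OF H x] by (simp add: inner_add_left[symmetric])
    ultimately show ?thesis by (simp add: has_derivative_at_withinI)
  qed
  from has_derivative_zero_constant[OF convex_\<Omega> this]
  obtain k where "\<And>x. x \<in> \<Omega> \<Longrightarrow> height 1 x + height (-1) x = k" by blast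
  then have "reflect_last (k / 2) ` M = M" by (intro symmetric_if_heights_opposite) simp
  then show ?thesis by blast
qed

end

theorem corollary2:
  fixes M G :: "((real ^ 'n) \<times> real) set"
  assumes "CARD('n) \<ge> 2"
    and "real_analytic_hypersurface M" and "M \<noteq> {}" and "compact M" and "connected M"
    and "open G" and "bounded G" and "frontier G = M" and "convex G"
    and "\<And>x a b. (x, a) \<in> M \<Longrightarrow> (x, b) \<in> M \<Longrightarrow> a \<ge> b \<Longrightarrow>
           (\<forall>\<theta>. 0 \<le> \<theta> \<and> \<theta> \<le> 1 \<longrightarrow> (x, \<theta> * a + (1 - \<theta>) * b) \<in> closure G) \<Longrightarrow>
           mean_curvature M G (x, a) \<le> mean_curvature M G (x, b)"
  shows "\<exists>c. reflect_last c ` M = M"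
proof -
  have "G \<noteq> {}" using assms(3,8) by auto
  then interpret analytic_convex_body M G
    using assms(2,6-9) by unfold_locales auto
  show ?thesis
  proof (rule symmetric_of_curvature_comparison)
    fix x assume x: "x \<in> \<Omega>"
    let ?a = "height 1 x" and ?b = "height (-1) x"
    show "mean_curvature M G (x, ?a) \<le> mean_curvature M G (x, ?b)"
    proof (rule assms(10))
      show "(x, ?a) \<in> M" "(x, ?b) \<in> M" using height_in_M[OF x] by auto
      show "?b \<le> ?a" using height_max(2)[OF x height_max(1)[OF x], of 1 "-1"] by simp
      show "\<forall>\<theta>. 0 \<le> \<theta> \<and> \<theta> \<le> 1 \<longrightarrow> (x, \<theta> * ?a + (1 - \<theta>) * ?b) \<in> closure G"
      proof (intro allI impI)
        fix \<theta> :: real assume \<theta>: "0 \<le> \<theta> \<and> \<theta> \<le> 1"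
        have "\<theta> *\<^sub>R (x, ?a) + (1 - \<theta>) *\<^sub>R (x, ?b) \<in> closure G"
          using \<theta> by (intro convexD[OF convex_closure[OF cvx]] height_max(1)[OF x]) auto
        then show "(x, \<theta> * ?a + (1 - \<theta>) * ?b) \<in> closure G"
          by (simp add: scaleR_add_left[symmetric])
      qed
    qed
  qed
qed

end
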